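(* Let $\Omega$ be a countably infinite set, $S=\mathrm{Sym}(\Omega)$, and let $\mathcal P$ be the set of partitions $A$ of $\Omega$ into finite subsets such that there is no common finite bound on the cardinalities of the members of $A$. Then the subgroups $S_{(A)}$ with $A\in\mathcal P$ are mutually $\approx$-equivalent, and a closed subgroup $G\le S$ is $\approx$-equivalent to these subgroups if and only if there exists a finite subset $\Gamma\subseteq\Omega$ such that all orbits of $G_{(\Gamma)}$ are finite, but there is no finite $\Gamma\subseteq\Omega$ for which the cardinalities of the orbits of $G_{(\Gamma)}$ have a common finite bound. Moreover, for $A\in\mathcal P$ one has $S_{(A)}\prec S$.
   Context: $\mathrm{Sym}(\Omega)$ is the group of all permutations of $\Omega$ (acting on the right). $S$ carries the function topology (pointwise convergence, $\Omega$ discrete); "closed" means closed in $S$. For a partition $A$ of $\Omega$, $S_{(A)}=\{f\in S:\Sigma f=\Sigma\text{ for all }\Sigma\in A\}$. For $G\le S$ and $\Gamma\subseteq\Omega$, $G_{(\Gamma)}$ is the pointwise stabilizer of $\Gamma$ in $G$. For subgroups $G_1,G_2\le S$: $G_1\preccurlyeq G_2$ means there is a finite $U\subseteq S$ with $G_1\le\langle G_2\cup U\rangle$; $G_1\approx G_2$ means $G_1\preccurlyeq G_2$ and $G_2\preccurlyeq G_1$; $G_1\prec G_2$ means $G_1\preccurlyeq G_2$ and not $G_2\preccurlyeq G_1$. *)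

theory Defs
  imports Main "HOL-Library.Countable"
begin

text \<open>Omega is the universe of a type 'a; permutations are bijections 'a \<Rightarrow> 'a.\<close>

definition Sym :: "('a \<Rightarrow> 'a) set" where
  "Sym = {f. bij f}"

inductive_set gen_by :: "('a \<Rightarrow> 'a) set \<Rightarrow> ('a \<Rightarrow> 'a) set" for X where
  gen_id: "id \<in> gen_by X"
| gen_base: "f \<in> X \<Longrightarrow> f \<in> gen_by X"
| gen_comp: "f \<in> gen_by X \<Longrightarrow> g \<in> gen_by X \<Longrightarrow> f \<circ> g \<in> gen_by X"
| gen_inv: "f \<in> gen_by X \<Longrightarrow> inv f \<in> gen_by X"

definition is_subgroup :: "('a \<Rightarrow> 'a) set \<Rightarrow> bool" where
  "is_subgroup G \<longleftrightarrow> G \<subseteq> Sym \<and> id \<in> G \<and>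
     (\<forall>f\<in>G. \<forall>g\<in>G. f \<circ> g \<in> G) \<and> (\<forall>f\<in>G. inv f \<in> G)"

text \<open>Closed in Sym with respect to the topology of pointwise convergence (Omega discrete):
  every permutation all of whose basic neighbourhoods meet G lies in G.\<close>
definition closed_in_Sym :: "('a \<Rightarrow> 'a) set \<Rightarrow> bool" where
  "closed_in_Sym G \<longleftrightarrow> (\<forall>f\<in>Sym. (\<forall>F. finite F \<longrightarrow> (\<exists>g\<in>G. \<forall>x\<in>F. g x = f x)) \<longrightarrow> f \<in> G)"

definition preceq :: "('a \<Rightarrow> 'a) set \<Rightarrow> ('a \<Rightarrow> 'a) set \<Rightarrow> bool" where
  "preceq G1 G2 \<longleftrightarrow> (\<exists>U. finite U \<and> U \<subseteq> Sym \<and> G1 \<subseteq> gen_by (G2 \<union> U))"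

definition equiv_sg :: "('a \<Rightarrow> 'a) set \<Rightarrow> ('a \<Rightarrow> 'a) set \<Rightarrow> bool" where
  "equiv_sg G1 G2 \<longleftrightarrow> preceq G1 G2 \<and> preceq G2 G1"

definition prec :: "('a \<Rightarrow> 'a) set \<Rightarrow> ('a \<Rightarrow> 'a) set \<Rightarrow> bool" where
  "prec G1 G2 \<longleftrightarrow> preceq G1 G2 \<and> \<not> preceq G2 G1"

definition Sym_part :: "'a set set \<Rightarrow> ('a \<Rightarrow> 'a) set" where
  "Sym_part A = {f \<in> Sym. \<forall>B\<in>A. f ` B = B}"

definition pstab :: "('a \<Rightarrow> 'a) set \<Rightarrow> 'a set \<Rightarrow> ('a \<Rightarrow> 'a) set" where
  "pstab G \<Gamma> = {g \<in> G. \<forall>x\<in>\<Gamma>. g x = x}"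

definition orbit_of :: "('a \<Rightarrow> 'a) set \<Rightarrow> 'a \<Rightarrow> 'a set" where
  "orbit_of H x = {h x | h. h \<in> H}"

definition finite_block_partition :: "'a set set \<Rightarrow> bool" where
  "finite_block_partition A \<longleftrightarrow> \<Union>A = UNIV \<and> {} \<notin> A \<and>
     (\<forall>B\<in>A. \<forall>C\<in>A. B \<noteq> C \<longrightarrow> B \<inter> C = {}) \<and> (\<forall>B\<in>A. finite B)"

definition unbounded_partitions :: "'a set set set" where
  "unbounded_partitions = {A. finite_block_partition A \<and> \<not> (\<exists>n::nat. \<forall>B\<in>A. card B \<le> n)}"

end

theory Submission
  imports Defs "HOL-Library.Countable_Set" "HOL-Library.Disjoint_Sets"
    "HOL-Combinatorics.Permutations"
begin

text \<open>
  If all orbits of \<open>pstab G \<Gamma>\<close> are finite for some finite \<open>\<Gamma>\<close>, then \<open>G\<close>, and every group below it,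
  is a countable union of sets with finite orbits, since \<open>pstab G \<Gamma>\<close> has countably many cosets.
  Conversely, a Baire category argument shows that a closed group \<open>G\<close> covered in this way has such a
  \<open>\<Gamma>\<close>. Moreover \<open>\<Omega>\<close> is then the union of a chain of finite sets across which each \<open>g \<in> G\<close> eventually
  moves points by at most one step; such a \<open>g\<close> is a product of a finitary permutation and of
  permutations preserving the even and the odd members of the chain, so \<open>G\<close> is below \<open>Sym_part A\<close>.

  The same covering argument with uniformly bounded orbits shows that \<open>Sym_part A\<close> is not below a group
  with bounded orbits. If the orbits are finite but never bounded, one permutation \<open>u\<close> can encode all
  permutations of infinitely many finite sets \<open>Z\<^sub>n\<close>: for each choice of these some \<open>g\<^sup>-\<^sup>1 u g\<close> with
  \<open>g \<in> G\<close> realizes it. The commutator with a shift of the \<open>Z\<^sub>n\<close> removes the uncontrolled part of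
  \<open>g\<^sup>-\<^sup>1 u g\<close> outside the \<open>Z\<^sub>n\<close>, so \<open>Sym_part A\<close> is below \<open>G\<close>.
\<close>


section \<open>Generation up to finitely many permutations\<close>

lemma is_subgroupD:
  assumes "is_subgroup G"
  shows "f \<in> G \<Longrightarrow> bij f" "id \<in> G" "f \<in> G \<Longrightarrow> g \<in> G \<Longrightarrow> f \<circ> g \<in> G" "f \<in> G \<Longrightarrow> inv f \<in> G"
  using assms unfolding is_subgroup_def Sym_def by auto

lemma comp_eq_iff_eq_comp_inv: "bij h \<Longrightarrow> f \<circ> h = g \<longleftrightarrow> f = g \<circ> inv h"
  by (metis bij_is_inj bij_is_surj comp_assoc comp_id inj_iff surj_iff)

lemma is_subgroup_Sym: "is_subgroup Sym"
  unfolding is_subgroup_def Sym_def by (auto intro: bij_comp bij_imp_bij_inv)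

lemma bij_inv_image_eq: "bij f \<Longrightarrow> f ` B = B \<Longrightarrow> inv f ` B = B"
  by (metis bij_is_inj image_inv_f_f)

lemma is_subgroup_Sym_part: "is_subgroup (Sym_part A)"
proof -
  have "(f \<circ> g) ` B = B" if "f ` B = B" "g ` B = B" for f g and B :: "'a set"
    using that by (metis image_comp)
  then show ?thesis
    unfolding is_subgroup_def Sym_part_def Sym_def
    by (auto simp: bij_inv_image_eq bij_imp_bij_inv simp del: o_apply intro: bij_comp)
qed

lemma is_subgroup_pstab:
  assumes "is_subgroup G"
  shows "is_subgroup (pstab G \<Gamma>)"
  using assms unfolding is_subgroup_def pstab_def Sym_def
  by (auto simp: bij_is_inj inv_f_eq)

lemma pstab_subset: "pstab G \<Gamma> \<subseteq> G"
  by (auto simp: pstab_def)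

lemma pstab_empty [simp]: "pstab G {} = G"
  by (simp add: pstab_def)

lemma pstab_pstab: "pstab (pstab G \<Gamma>) \<Delta> = pstab G (\<Gamma> \<union> \<Delta>)"
  by (auto simp: pstab_def)

lemma closed_in_Sym_pstab:
  assumes "closed_in_Sym G"
  shows "closed_in_Sym (pstab G \<Gamma>)"
  unfolding closed_in_Sym_def
proof (intro ballI impI)
  fix f assume f: "f \<in> Sym" and approx: "\<forall>F. finite F \<longrightarrow> (\<exists>g\<in>pstab G \<Gamma>. \<forall>x\<in>F. g x = f x)"
  have "\<exists>g\<in>G. \<forall>x\<in>F. g x = f x" if "finite F" for F
    using approx that pstab_subset by blast
  then have "f \<in> G" using assms f unfolding closed_in_Sym_def by simp
  moreover have "f x = x" if "x \<in> \<Gamma>" for x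
    using approx[rule_format, of "{x}"] that by (auto simp: pstab_def)
  ultimately show "f \<in> pstab G \<Gamma>" by (simp add: pstab_def)
qed

lemma gen_by_subset:
  assumes "X \<subseteq> gen_by Y"
  shows "gen_by X \<subseteq> gen_by Y"
proof
  fix f assume "f \<in> gen_by X"
  then show "f \<in> gen_by Y"
    by induction (use assms in \<open>blast intro: gen_by.intros\<close>)+
qed

lemma gen_by_mono: "X \<subseteq> Y \<Longrightarrow> gen_by X \<subseteq> gen_by Y"
  by (intro gen_by_subset) (auto intro: gen_by.gen_base)

lemma preceq_gen_by:
  assumes "G \<subseteq> gen_by X" "preceq X H"
  shows "preceq G H"
proof -
  obtain U where U: "finite U" "U \<subseteq> Sym" "X \<subseteq> gen_by (H \<union> U)"
    using assms(2) unfolding preceq_def by blast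
  then have "G \<subseteq> gen_by (H \<union> U)" using gen_by_subset[OF U(3)] assms(1) by blast
  then show ?thesis unfolding preceq_def using U by blast
qed

lemma preceq_finite: "finite U \<Longrightarrow> U \<subseteq> Sym \<Longrightarrow> preceq U H"
  unfolding preceq_def by (intro exI[of _ U]) (auto intro: gen_by.gen_base)

lemma preceq_subset: "G \<subseteq> H \<Longrightarrow> preceq G H"
  unfolding preceq_def by (intro exI[of _ "{}"]) (auto intro: gen_by.gen_base)

lemma preceq_Un:
  assumes "preceq G H" "preceq G' H"
  shows "preceq (G \<union> G') H"
proof -
  obtain U V where U: "finite U" "U \<subseteq> Sym" "G \<subseteq> gen_by (H \<union> U)"
    and V: "finite V" "V \<subseteq> Sym" "G' \<subseteq> gen_by (H \<union> V)"
    using assms unfolding preceq_def by blast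
  have "gen_by (H \<union> U) \<subseteq> gen_by (H \<union> (U \<union> V))" "gen_by (H \<union> V) \<subseteq> gen_by (H \<union> (U \<union> V))"
    by (intro gen_by_mono; blast)+
  then show ?thesis
    unfolding preceq_def using U V by (intro exI[of _ "U \<union> V"]) auto
qed

lemma preceq_trans [trans]:
  assumes "preceq G H" "preceq H K"
  shows "preceq G K"
proof -
  obtain U where U: "finite U" "U \<subseteq> Sym" "G \<subseteq> gen_by (H \<union> U)"
    using assms(1) unfolding preceq_def by blast
  show ?thesis
    using U(3) by (rule preceq_gen_by) (intro preceq_Un assms(2) preceq_finite U(1,2))
qed


section \<open>Permutations preserving the members of a family\<close>

lemma glue_bijections:
  fixes f :: "'i \<Rightarrow> 'a \<Rightarrow> 'b"
  assumes "disjoint_family_on A I" "disjoint_family_on B I"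
    and bij: "\<And>i. i \<in> I \<Longrightarrow> bij_betw (f i) (A i) (B i)"
  obtains u where "bij_betw u (\<Union>i\<in>I. A i) (\<Union>i\<in>I. B i)"
    "\<And>i x. i \<in> I \<Longrightarrow> x \<in> A i \<Longrightarrow> u x = f i x"
proof -
  define u where "u x = f (THE i. i \<in> I \<and> x \<in> A i) x" for x
  have u: "u x = f i x" if "i \<in> I" "x \<in> A i" for i x
  proof -
    have "(THE i. i \<in> I \<and> x \<in> A i) = i"
      using assms(1) that by (intro the_equality) (auto simp: disjoint_family_on_def)
    then show ?thesis by (simp add: u_def)
  qed
  moreover have "bij_betw u (\<Union>i\<in>I. A i) (\<Union>i\<in>I. B i)"
  proof (rule bij_betw_UNION_disjoint[OF assms(2)])
    show "bij_betw u (A i) (B i)" if "i \<in> I" for i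
      using bij[OF that] u[OF that] by (simp cong: bij_betw_cong)
  qed
  ultimately show ?thesis using that by blast
qed

lemma glue_permutations:
  fixes \<rho> :: "'i \<Rightarrow> 'a \<Rightarrow> 'a"
  assumes "disjoint_family_on T I" and \<rho>: "\<And>i. i \<in> I \<Longrightarrow> bij_betw (\<rho> i) (T i) (T i)"
  obtains u where "u permutes (\<Union>i\<in>I. T i)" "\<And>i x. i \<in> I \<Longrightarrow> x \<in> T i \<Longrightarrow> u x = \<rho> i x"
    "\<And>i. i \<in> I \<Longrightarrow> u ` T i = T i"
proof -
  obtain f where f: "bij_betw f (\<Union>i\<in>I. T i) (\<Union>i\<in>I. T i)" "\<And>i x. i \<in> I \<Longrightarrow> x \<in> T i \<Longrightarrow> f x = \<rho> i x"
    by (rule glue_bijections[OF assms(1,1) \<rho>]) blast+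
  let ?u = "restrict_id f (\<Union>i\<in>I. T i)"
  have u: "?u x = \<rho> i x" if "i \<in> I" "x \<in> T i" for i x
    using that f(2)[OF that] by (subst restrict_id_simps(1)) auto
  moreover have "?u ` T i = T i" if "i \<in> I" for i
    using bij_betw_imp_surj_on[OF \<rho>[OF that]] u[OF that] by (simp cong: image_cong)
  ultimately show ?thesis using permutes_restrict_id[OF f(1)] that by blast
qed

lemma extend_injection_to_bij:
  fixes f :: "'a::countable \<Rightarrow> 'b::countable"
  assumes "inj_on f X" "infinite (- X)" "infinite (- f ` X)"
  obtains u where "bij u" "\<And>x. x \<in> X \<Longrightarrow> u x = f x"
proof -
  obtain e where "bij_betw e (- X) (- f ` X)"
    using to_nat_on_infinite[OF _ assms(2)] to_nat_on_infinite[OF _ assms(3)]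
      bij_betw_trans bij_betw_inv_into by blast
  moreover have "bij_betw f X (f ` X)" using assms(1) by (rule inj_on_imp_bij_betw)
  ultimately have "bij_betw (\<lambda>x. if x \<in> X then f x else e x) (X \<union> - X) (f ` X \<union> - f ` X)"
    by (intro bij_betw_disjoint_Un) auto
  then show ?thesis using that[of "\<lambda>x. if x \<in> X then f x else e x"] by (simp add: Compl_partition)
qed

definition Sym_blocks :: "'a set set \<Rightarrow> ('a \<Rightarrow> 'a) set" where
  "Sym_blocks \<D> = {f \<in> Sym_part \<D>. f permutes \<Union>\<D>}"

lemma Sym_blocks_iff: "f \<in> Sym_blocks \<D> \<longleftrightarrow> f permutes \<Union>\<D> \<and> (\<forall>B\<in>\<D>. f ` B = B)"
  by (auto simp: Sym_blocks_def Sym_part_def Sym_def permutes_bij)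

lemma Sym_blocks_eq_Sym_part: "\<Union>\<D> = UNIV \<Longrightarrow> Sym_blocks \<D> = Sym_part \<D>"
  by (auto simp: Sym_blocks_def Sym_part_def Sym_def permutes_altdef)

lemma Sym_blocks_fixes: "f \<in> Sym_blocks \<D> \<Longrightarrow> x \<notin> \<Union>\<D> \<Longrightarrow> f x = x"
  unfolding Sym_blocks_iff by (blast intro: permutes_not_in)

lemma Sym_blocks_inv: "f \<in> Sym_blocks \<D> \<Longrightarrow> inv f \<in> Sym_blocks \<D>"
  unfolding Sym_blocks_def by (simp add: is_subgroupD(4)[OF is_subgroup_Sym_part] permutes_inv)

lemma Sym_blocks_image_eq:
  assumes f: "f \<in> Sym_blocks \<D>" and B: "\<And>D. D \<in> \<D> \<Longrightarrow> D \<subseteq> B \<or> D \<inter> B = {}"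
  shows "f ` B = B"
proof -
  have stable: "g ` B \<subseteq> B" if "g \<in> Sym_blocks \<D>" for g
  proof (rule image_subsetI)
    fix x assume x: "x \<in> B"
    show "g x \<in> B"
    proof (cases "x \<in> \<Union>\<D>")
      case True
      then obtain D where D: "D \<in> \<D>" "x \<in> D" by blast
      then have "g x \<in> D" using that by (auto simp: Sym_blocks_iff)
      then show ?thesis using B[OF D(1)] D(2) x by blast
    next
      case False
      then show ?thesis using Sym_blocks_fixes[OF that] x by simp
    qed
  qed
  have "f ` (inv f ` B) = B" using f by (simp add: Sym_blocks_def Sym_part_def Sym_def image_f_inv_f bij_is_surj)
  then show ?thesis using stable[OF f] stable[OF Sym_blocks_inv[OF f]] by blast
qed

lemma Sym_blocks_refine:
  assumes "disjoint \<B>" "\<And>D. D \<in> \<D> \<Longrightarrow> \<exists>B\<in>\<B>. D \<subseteq> B"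
  shows "Sym_blocks \<D> \<subseteq> Sym_blocks \<B>"
proof
  fix f assume f: "f \<in> Sym_blocks \<D>"
  have "\<Union>\<D> \<subseteq> \<Union>\<B>" using assms(2) by blast
  then have "f permutes \<Union>\<B>" using f permutes_subset by (auto simp: Sym_blocks_iff)
  moreover have "f ` B = B" if "B \<in> \<B>" for B
    using f
  proof (rule Sym_blocks_image_eq)
    fix D assume "D \<in> \<D>"
    then obtain B' where "B' \<in> \<B>" "D \<subseteq> B'" using assms(2) by blast
    then show "D \<subseteq> B \<or> D \<inter> B = {}" using disjointD[OF assms(1) that, of B'] by blast
  qed
  ultimately show "f \<in> Sym_blocks \<B>" by (simp add: Sym_blocks_iff)
qed

lemma bij_permutesI: "bij f \<Longrightarrow> (\<And>x. x \<notin> S \<Longrightarrow> f x = x) \<Longrightarrow> f permutes S"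
  by (auto intro: permutes_superset[of f UNIV] bij_imp_permutes)

lemma Sym_blocks_conjugate:
  assumes u: "bij u" and g: "g \<in> Sym_blocks \<D>"
  shows "u \<circ> g \<circ> inv u \<in> Sym_blocks ((`) u ` \<D>)"
proof -
  have conj: "(u \<circ> g \<circ> inv u) (u x) = u (g x)" for x
    using u by (simp add: bij_is_inj)
  have "(u \<circ> g \<circ> inv u) ` u ` D = u ` g ` D" for D
    unfolding image_image conj ..
  moreover have "u \<circ> g \<circ> inv u permutes \<Union>((`) u ` \<D>)"
  proof (rule bij_permutesI)
    show "bij (u \<circ> g \<circ> inv u)"
      using u g by (auto simp: Sym_blocks_def Sym_part_def Sym_def intro: bij_comp bij_imp_bij_inv)
    fix y assume y: "y \<notin> \<Union>((`) u ` \<D>)"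
    obtain x where x: "y = u x" using u by (metis bij_pointE)
    then have "g x = x" using y by (intro Sym_blocks_fixes[OF g]) blast
    then show "(u \<circ> g \<circ> inv u) y = y" using conj x by simp
  qed
  ultimately show ?thesis using g by (simp add: Sym_blocks_iff)
qed

definition unbounded_family :: "'a set set \<Rightarrow> bool" where
  "unbounded_family \<B> \<longleftrightarrow> disjoint \<B> \<and> (\<forall>B\<in>\<B>. finite B) \<and> (\<forall>m. \<exists>B\<in>\<B>. m < card B)"

lemma unbounded_family_choice:
  fixes f :: "nat \<Rightarrow> nat" and \<B> :: "'a set set"
  assumes \<B>: "unbounded_family \<B>"
  obtains C where "disjoint_family C" "\<And>n. C n \<in> \<B>" "\<And>n. f n < card (C n)"
proof -
  have large: "\<exists>B\<in>\<B>. m < card B" for m using \<B> by (simp add: unbounded_family_def)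
  have "\<exists>C. \<forall>n. (C n \<in> \<B> \<and> f n < card (C n)) \<and> card (C n) < card (C (Suc n))"
  proof (rule dependent_nat_choice)
    show "\<exists>B. B \<in> \<B> \<and> f 0 < card B" using large by blast
    show "\<exists>B'. (B' \<in> \<B> \<and> f (Suc n) < card B') \<and> card B < card B'" for B :: "'a set" and n
      using large[of "max (f (Suc n)) (card B)"] by auto
  qed
  then obtain C where C: "\<And>n. C n \<in> \<B>" "\<And>n. f n < card (C n)" "\<And>n. card (C n) < card (C (Suc n))"
    by blast
  then have "inj (card \<circ> C)" by (intro strict_mono_imp_inj_on) (simp add: strict_mono_Suc_iff)
  then have "inj C" by (rule inj_on_imageI2)
  moreover have "disjoint (range C)"
    using C(1) \<B> by (auto simp: unbounded_family_def intro: pairwise_subset)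
  ultimately show ?thesis using that disjoint_image_disjoint_family_on C(1,2) by blast
qed

lemma ex_inj_on_image_psubset:
  assumes "finite A" "finite B" "card A < card B"
  shows "\<exists>f. inj_on f A \<and> f ` A \<subset> B"
proof -
  obtain f where f: "f ` A \<subseteq> B" "inj_on f A"
    using card_le_inj[OF assms(1,2) less_imp_le[OF assms(3)]] by blast
  then have "f ` A \<noteq> B" using assms(3) card_image by fastforce
  then show ?thesis using f by blast
qed

lemma conjugate_family_into_blocks:
  fixes D :: "nat \<Rightarrow> 'a::countable set" and \<B> :: "'a set set"
  assumes \<B>: "unbounded_family \<B>"
    and D: "disjoint_family D" "\<And>n. finite (D n)" "infinite (- (\<Union>n. D n))"
  obtains u where "bij u" "\<And>n. \<exists>B\<in>\<B>. u ` D n \<subseteq> B"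
proof -
  obtain C where C: "disjoint_family C" "\<And>n. C n \<in> \<B>" "\<And>n. card (D n) < card (C n)"
    using unbounded_family_choice[OF \<B>, of "\<lambda>n. card (D n)"] by blast
  have "finite (C n)" for n using C(2) \<B> by (simp add: unbounded_family_def)
  with D(2) have "\<exists>\<phi>. inj_on \<phi> (D n) \<and> \<phi> ` D n \<subset> C n" for n
    using C(3) by (rule ex_inj_on_image_psubset)
  then obtain \<phi> where \<phi>: "\<And>n. inj_on (\<phi> n) (D n)" and \<phi>_proper: "\<And>n. \<phi> n ` D n \<subset> C n" by metis
  then have \<phi>_subset: "\<phi> n ` D n \<subseteq> C n" and \<phi>_missed: "C n - \<phi> n ` D n \<noteq> {}" for n
    using \<phi>_proper[of n] by blast+
  have "disjoint_family (\<lambda>n. \<phi> n ` D n)"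
    using C(1) by (rule disjoint_family_subset) (rule \<phi>_subset)
  then obtain f where f: "bij_betw f (\<Union>n. D n) (\<Union>n. \<phi> n ` D n)" "\<And>n x. x \<in> D n \<Longrightarrow> f x = \<phi> n x"
    by (rule glue_bijections[OF D(1), of "\<lambda>n. \<phi> n ` D n" \<phi>])
      (use \<phi> in \<open>auto intro: inj_on_imp_bij_betw\<close>)
  have "infinite (\<Union>n. C n - \<phi> n ` D n)"
  proof (rule infinite_disjoint_family_imp_infinite_UNION)
    show "disjoint_family (\<lambda>n. C n - \<phi> n ` D n)"
      using C(1) by (rule disjoint_family_subset) blast
  qed (use \<phi>_missed in \<open>simp_all only: infinite_UNIV_nat not_False_eq_True\<close>)
  moreover have "y \<notin> \<phi> m ` D m" if "y \<in> C n - \<phi> n ` D n" for y m n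
    using that \<phi>_subset[of m] disjoint_family_onD[OF C(1), of m n] by (cases "m = n") auto
  then have "(\<Union>n. C n - \<phi> n ` D n) \<subseteq> - f ` (\<Union>n. D n)"
    unfolding bij_betw_imp_surj_on[OF f(1)] by blast
  ultimately have "infinite (- f ` (\<Union>n. D n))" using finite_subset by blast
  then obtain u where u: "bij u" "\<And>x. x \<in> (\<Union>n. D n) \<Longrightarrow> u x = f x"
    using extend_injection_to_bij[OF bij_betw_imp_inj_on[OF f(1)] D(3)] by blast
  have "u ` D n = \<phi> n ` D n" for n
  proof (rule image_cong)
    show "u x = \<phi> n x" if "x \<in> D n" for x using u(2)[of x] f(2)[OF that] that by auto
  qed simp
  then have "u ` D n \<subseteq> C n" for n using \<phi>_subset[of n] by simp
  then show ?thesis using that[OF u(1)] C(2) by blast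
qed

lemma Sym_blocks_preceq_infinite_compl:
  fixes D :: "nat \<Rightarrow> 'a::countable set" and \<B> :: "'a set set"
  assumes \<B>: "unbounded_family \<B>"
    and D: "disjoint_family D" "\<And>n. finite (D n)" "infinite (- (\<Union>n. D n))"
  shows "preceq (Sym_blocks (range D)) (Sym_blocks \<B>)"
proof -
  obtain u where u: "bij u" "\<And>n. \<exists>B\<in>\<B>. u ` D n \<subseteq> B"
    using conjugate_family_into_blocks[OF \<B> D] by blast
  have "g \<in> gen_by (Sym_blocks \<B> \<union> {u})" if "g \<in> Sym_blocks (range D)" for g
  proof -
    have "u \<circ> g \<circ> inv u \<in> Sym_blocks ((`) u ` range D)"
      using u(1) that by (rule Sym_blocks_conjugate)
    also have "\<dots> \<subseteq> Sym_blocks \<B>" using \<B> u(2) by (intro Sym_blocks_refine) (auto simp: unbounded_family_def)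
    finally have "inv u \<circ> ((u \<circ> g \<circ> inv u) \<circ> u) \<in> gen_by (Sym_blocks \<B> \<union> {u})"
      by (intro gen_by.gen_comp gen_by.gen_inv gen_by.gen_base) auto
    moreover have "inv u \<circ> ((u \<circ> g \<circ> inv u) \<circ> u) = g"
      using u(1) by (simp add: fun_eq_iff bij_is_inj)
    ultimately show ?thesis by simp
  qed
  then show ?thesis
    unfolding preceq_def using u(1) by (intro exI[of _ "{u}"]) (auto simp: Sym_def)
qed

lemma Sym_blocks_Un_subset_gen_by:
  assumes "\<Union>\<D> \<inter> \<Union>\<E> = {}"
  shows "Sym_blocks (\<D> \<union> \<E>) \<subseteq> gen_by (Sym_blocks \<D> \<union> Sym_blocks \<E>)"
proof
  fix g assume g: "g \<in> Sym_blocks (\<D> \<union> \<E>)"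
  have restrict: "restrict_id g (\<Union>\<F>) \<in> Sym_blocks \<F>" if "\<F> \<subseteq> \<D> \<union> \<E>" for \<F>
  proof -
    have image: "g ` B = B" if "B \<in> \<F>" for B using g that \<open>\<F> \<subseteq> _\<close> by (auto simp: Sym_blocks_iff)
    then have "g ` \<Union>\<F> = \<Union>\<F>" by (simp add: image_Union)
    then have "bij_betw g (\<Union>\<F>) (\<Union>\<F>)"
      using g by (auto simp: Sym_blocks_iff intro: bij_betw_imageI permutes_inj_on)
    moreover have "restrict_id g (\<Union>\<F>) ` B = g ` B" if "B \<in> \<F>" for B
      using that by (intro image_cong refl restrict_id_simps) blast
    ultimately show ?thesis using image by (simp add: Sym_blocks_iff permutes_restrict_id)
  qed
  have "g = restrict_id g (\<Union>\<D>) \<circ> restrict_id g (\<Union>\<E>)"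
  proof
    fix x
    show "g x = (restrict_id g (\<Union>\<D>) \<circ> restrict_id g (\<Union>\<E>)) x"
    proof (cases "x \<in> \<Union>\<E>")
      case True
      then have "g x \<in> \<Union>\<E>" using g by (auto simp: Sym_blocks_iff)
      then have "g x \<notin> \<Union>\<D>" using assms by blast
      then show ?thesis using True by (simp del: Union_iff)
    next
      case False
      moreover have "g x = x" if "x \<notin> \<Union>\<D>" using that False by (intro Sym_blocks_fixes[OF g]) blast
      ultimately show ?thesis by (cases "x \<in> \<Union>\<D>") (simp_all del: Union_iff)
    qed
  qed
  moreover have "restrict_id g (\<Union>\<D>) \<circ> restrict_id g (\<Union>\<E>) \<in> gen_by (Sym_blocks \<D> \<union> Sym_blocks \<E>)"
    using restrict[of \<D>] restrict[of \<E>] by (intro gen_by.gen_comp gen_by.gen_base) auto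
  ultimately show "g \<in> gen_by (Sym_blocks \<D> \<union> Sym_blocks \<E>)" by simp
qed

lemma Sym_blocks_preceq:
  fixes D :: "nat \<Rightarrow> 'a::countable set" and \<B> :: "'a set set"
  assumes \<B>: "unbounded_family \<B>"
    and D: "disjoint_family D" "\<And>n. finite (D n)" "\<And>n. D n \<noteq> {}"
  shows "preceq (Sym_blocks (range D)) (Sym_blocks \<B>)"
proof -
  define E where "E r n = D (2 * n + r)" for r n :: nat
  have E: "disjoint_family (E r)" "finite (E r n)" "infinite (\<Union>n. E r n)" for r n
  proof -
    show "disjoint_family (E r)" using D(1) by (auto simp: E_def disjoint_family_on_def)
    then show "infinite (\<Union>n. E r n)"
      by (rule infinite_disjoint_family_imp_infinite_UNION[rotated 2]) (simp_all add: E_def D(3))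
  qed (simp add: E_def D(2))
  have "E 0 m \<inter> E 1 n = {}" for m n
  proof -
    have "2 * m + 0 \<noteq> 2 * n + 1" by presburger
    then show ?thesis unfolding E_def by (rule disjoint_family_onD[OF D(1) UNIV_I UNIV_I])
  qed
  then have disjoint_unions: "(\<Union>n. E 0 n) \<inter> (\<Union>n. E 1 n) = {}" by blast
  have half: "preceq (Sym_blocks (range (E r))) (Sym_blocks \<B>)" if "r \<in> {0, 1}" for r
  proof (rule Sym_blocks_preceq_infinite_compl[OF \<B> E(1,2)])
    from that consider "r = 0" | "r = 1" by blast
    then have "(\<Union>n. E (1 - r) n) \<subseteq> - (\<Union>n. E r n)"
      using disjoint_unions by cases auto
    then show "infinite (- (\<Union>n. E r n))" by (rule infinite_super[OF _ E(3)])
  qed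
  have "range D \<subseteq> range (E 0) \<union> range (E 1)"
  proof (rule image_subsetI)
    fix n :: nat
    have "D n = E 0 (n div 2)" if "even n" using that by (simp add: E_def)
    moreover have "D n = E 1 (n div 2)" if "odd n" using that by (simp add: E_def)
    ultimately show "D n \<in> range (E 0) \<union> range (E 1)" by blast
  qed
  then have "range D = range (E 0) \<union> range (E 1)" by (auto simp: E_def)
  then have "Sym_blocks (range D) \<subseteq> gen_by (Sym_blocks (range (E 0)) \<union> Sym_blocks (range (E 1)))"
    using Sym_blocks_Un_subset_gen_by[of "range (E 0)" "range (E 1)"] disjoint_unions by simp
  then show ?thesis by (rule preceq_gen_by) (intro preceq_Un half; simp)
qed

lemma finite_block_partitionD:
  assumes "finite_block_partition A"
  shows "\<Union>A = UNIV" "disjoint A" "B \<in> A \<Longrightarrow> finite B" "B \<in> A \<Longrightarrow> B \<noteq> {}"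
  using assms by (auto simp: finite_block_partition_def disjoint_def)

lemma unbounded_partitionsD:
  assumes "A \<in> unbounded_partitions"
  shows "finite_block_partition A" "unbounded_family A"
  using assms finite_block_partitionD(2,3)[of A]
  by (auto simp: unbounded_partitions_def unbounded_family_def not_le)

lemma finite_block_partition_enumeration:
  fixes A :: "'a::countable set set"
  assumes A: "finite_block_partition A" and "infinite (UNIV :: 'a set)"
  obtains D :: "nat \<Rightarrow> 'a set" where "A = range D" "disjoint_family D"
proof -
  have "infinite A"
    using assms(2) finite_Union[of A] finite_block_partitionD(1,3)[OF A] by metis
  moreover have "countable A"
    by (rule countable_subset[OF _ countable_Collect_finite]) (use finite_block_partitionD(3)[OF A] in auto)
  ultimately have "bij_betw (from_nat_into A) UNIV A" by (intro bij_betw_from_nat_into)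
  then have "range (from_nat_into A) = A" "inj (from_nat_into A)" by (auto simp: bij_betw_def)
  then show ?thesis
    using that disjoint_image_disjoint_family_on[of "from_nat_into A" UNIV] finite_block_partitionD(2)[OF A]
    by metis
qed

lemma Sym_part_preceq_Sym_blocks:
  fixes A \<B> :: "'a::countable set set"
  assumes "infinite (UNIV :: 'a set)" and A: "finite_block_partition A"
    and \<B>: "unbounded_family \<B>"
  shows "preceq (Sym_part A) (Sym_blocks \<B>)"
proof -
  obtain D :: "nat \<Rightarrow> 'a set" where D: "A = range D" "disjoint_family D"
    using finite_block_partition_enumeration[OF A assms(1)] by blast
  have "finite (D n)" "D n \<noteq> {}" for n
    using finite_block_partitionD(3,4)[OF A, of "D n"] D(1) by blast+
  with \<B> D(2) have "preceq (Sym_blocks (range D)) (Sym_blocks \<B>)"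
    by (rule Sym_blocks_preceq)
  then show ?thesis using D(1) finite_block_partitionD(1)[OF A] by (simp add: Sym_blocks_eq_Sym_part)
qed

lemma Sym_part_preceq_Sym_part:
  fixes A B :: "'a::countable set set"
  assumes "infinite (UNIV :: 'a set)" "finite_block_partition A" "B \<in> unbounded_partitions"
  shows "preceq (Sym_part A) (Sym_part B)"
proof -
  have "preceq (Sym_part A) (Sym_blocks B)"
    using assms(1,2) unbounded_partitionsD(2)[OF assms(3)] by (rule Sym_part_preceq_Sym_blocks)
  then show ?thesis
    by (simp add: Sym_blocks_eq_Sym_part finite_block_partitionD(1)[OF unbounded_partitionsD(1)[OF assms(3)]])
qed


section \<open>Countable unions of sets with finite orbits\<close>

definition finite_orbits :: "('a \<Rightarrow> 'a) set \<Rightarrow> bool" where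
  "finite_orbits H \<longleftrightarrow> (\<forall>x. finite (orbit_of H x))"

definition bounded_orbits :: "('a \<Rightarrow> 'a) set \<Rightarrow> bool" where
  "bounded_orbits H \<longleftrightarrow> (\<exists>n. \<forall>x. finite (orbit_of H x) \<and> card (orbit_of H x) \<le> n)"

definition comps :: "('a \<Rightarrow> 'a) set \<Rightarrow> ('a \<Rightarrow> 'a) set \<Rightarrow> ('a \<Rightarrow> 'a) set" where
  "comps H K = {h \<circ> k | h k. h \<in> H \<and> k \<in> K}"

lemma orbit_of_mono: "H \<subseteq> K \<Longrightarrow> orbit_of H x \<subseteq> orbit_of K x"
  by (auto simp: orbit_of_def)

lemma orbit_of_Un: "orbit_of (H \<union> K) x = orbit_of H x \<union> orbit_of K x"
  by (auto simp: orbit_of_def)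

lemma orbit_of_eq_image: "orbit_of H x = (\<lambda>h. h x) ` H"
  by (auto simp: orbit_of_def)

lemma orbit_of_comps: "orbit_of (comps H K) x = (\<Union>y\<in>orbit_of K x. orbit_of H y)"
  by (fastforce simp: orbit_of_def comps_def)

lemma finite_orbits_subset: "finite_orbits K \<Longrightarrow> H \<subseteq> K \<Longrightarrow> finite_orbits H"
  unfolding finite_orbits_def by (blast intro: finite_subset[OF orbit_of_mono])

lemma unbounded_orbitsD:
  assumes "finite_orbits H" "\<not> bounded_orbits H"
  shows "\<exists>x. n < card (orbit_of H x)"
  using assms by (auto simp: bounded_orbits_def finite_orbits_def not_le)

locale orbit_property =
  fixes Q :: "('a::countable \<Rightarrow> 'a) set \<Rightarrow> bool"
  assumes finite: "finite F \<Longrightarrow> Q F"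
    and union: "Q H \<Longrightarrow> Q K \<Longrightarrow> Q (H \<union> K)"
    and comps: "Q H \<Longrightarrow> Q K \<Longrightarrow> Q (comps H K)"

interpretation finite_orbits: orbit_property finite_orbits
proof
  show "finite_orbits F" if "finite F" for F :: "('a \<Rightarrow> 'a) set"
    using that by (simp add: finite_orbits_def orbit_of_eq_image)
qed (simp_all add: finite_orbits_def orbit_of_Un orbit_of_comps)

lemma bounded_orbits_comps:
  assumes "bounded_orbits H" "bounded_orbits K"
  shows "bounded_orbits (comps H K)"
proof -
  obtain m n where H: "\<And>x. finite (orbit_of H x)" "\<And>x. card (orbit_of H x) \<le> m"
    and K: "\<And>x. finite (orbit_of K x)" "\<And>x. card (orbit_of K x) \<le> n"
    using assms unfolding bounded_orbits_def by metis
  have "card (orbit_of (comps H K) x) \<le> n * m" for x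
  proof -
    have "card (orbit_of (comps H K) x) \<le> (\<Sum>y\<in>orbit_of K x. card (orbit_of H y))"
      unfolding orbit_of_comps by (rule card_UN_le[OF K(1)])
    also have "\<dots> \<le> card (orbit_of K x) * m"
      using sum_bounded_above[of "orbit_of K x" "\<lambda>y. card (orbit_of H y)" m] H(2) by simp
    also have "\<dots> \<le> n * m" using K(2) by (rule mult_le_mono1)
    finally show ?thesis .
  qed
  moreover have "finite (orbit_of (comps H K) x)" for x
    unfolding orbit_of_comps using H(1) K(1) by simp
  ultimately show ?thesis unfolding bounded_orbits_def by blast
qed

lemma bounded_orbits_Un:
  assumes "bounded_orbits H" "bounded_orbits K"
  shows "bounded_orbits (H \<union> K)"
proof -
  obtain m n where H: "\<And>x. finite (orbit_of H x)" "\<And>x. card (orbit_of H x) \<le> m"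
    and K: "\<And>x. finite (orbit_of K x)" "\<And>x. card (orbit_of K x) \<le> n"
    using assms unfolding bounded_orbits_def by metis
  have "card (orbit_of (H \<union> K) x) \<le> m + n" for x
    unfolding orbit_of_Un by (rule order_trans[OF card_Un_le add_mono[OF H(2) K(2)]])
  then show ?thesis using H(1) K(1) by (auto simp: bounded_orbits_def orbit_of_Un)
qed

interpretation bounded_orbits: orbit_property bounded_orbits
proof
  show "bounded_orbits F" if "finite F" for F :: "('a \<Rightarrow> 'a) set"
    unfolding bounded_orbits_def orbit_of_eq_image using that card_image_le by blast
qed (rule bounded_orbits_Un bounded_orbits_comps; assumption)+

definition countably_covered :: "(('a \<Rightarrow> 'a) set \<Rightarrow> bool) \<Rightarrow> ('a \<Rightarrow> 'a) set \<Rightarrow> bool" where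
  "countably_covered Q X \<longleftrightarrow> (\<exists>W :: nat \<Rightarrow> ('a \<Rightarrow> 'a) set. X \<subseteq> (\<Union>k. W k) \<and> (\<forall>k. Q (W k)))"

definition some_pstab :: "(('a \<Rightarrow> 'a) set \<Rightarrow> bool) \<Rightarrow> ('a \<Rightarrow> 'a) set \<Rightarrow> bool" where
  "some_pstab Q G \<longleftrightarrow> (\<exists>\<Gamma>. finite \<Gamma> \<and> Q (pstab G \<Gamma>))"

lemma some_pstabI: "Q G \<Longrightarrow> some_pstab Q G"
  unfolding some_pstab_def by (metis finite.emptyI pstab_empty)

lemma some_pstab_pstab: "some_pstab Q (pstab G \<Gamma>) \<Longrightarrow> finite \<Gamma> \<Longrightarrow> some_pstab Q G"
  unfolding some_pstab_def pstab_pstab by (metis finite_Un)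

lemma coset_factorization:
  assumes G: "is_subgroup G" and "c \<in> G" "g \<in> G" and agree: "\<And>x. x \<in> \<Gamma> \<Longrightarrow> c x = g x"
  obtains h where "h \<in> pstab G \<Gamma>" "g = c \<circ> h"
proof
  have c: "bij c" using is_subgroupD(1)[OF G \<open>c \<in> G\<close>] .
  then show "g = c \<circ> (inv c \<circ> g)" by (simp add: fun_eq_iff bij_is_surj surj_f_inv_f)
  have "inv c (g x) = x" if "x \<in> \<Gamma>" for x
    using agree[OF that] c by (metis bij_inv_eq_iff)
  then show "inv c \<circ> g \<in> pstab G \<Gamma>"
    using is_subgroupD(3,4)[OF G] assms(2,3) by (simp add: pstab_def)
qed

lemma coset_representatives:
  fixes G :: "('a::countable \<Rightarrow> 'a) set"
  assumes G: "is_subgroup G" and "finite \<Gamma>"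
  obtains C where "C \<subseteq> G" "countable C" "finite_orbits G \<Longrightarrow> finite C"
    "\<And>g. g \<in> G \<Longrightarrow> \<exists>c\<in>C. \<exists>h\<in>pstab G \<Gamma>. g = c \<circ> h"
proof -
  obtain xs where xs: "set xs = \<Gamma>" using finite_list[OF assms(2)] by blast
  obtain C where C: "C \<subseteq> G" "inj_on (\<lambda>g. map g xs) C" "(\<lambda>g. map g xs) ` G = (\<lambda>g. map g xs) ` C"
    using subset_image_inj[of "(\<lambda>g. map g xs) ` G" "\<lambda>g. map g xs" G] by auto
  have "countable C" using C(2) by (rule countable_image_inj_on[rotated]) simp
  moreover have "finite C" if "finite_orbits G"
  proof (rule inj_on_finite[OF C(2)])
    let ?Y = "\<Union>x\<in>\<Gamma>. orbit_of G x"
    show "finite {ys. set ys \<subseteq> ?Y \<and> length ys = length xs}"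
      using that assms(2) by (intro finite_lists_length_eq) (simp add: finite_orbits_def)
    have "g ` \<Gamma> \<subseteq> ?Y" if "g \<in> C" for g using that C(1) unfolding orbit_of_def by blast
    then show "(\<lambda>g. map g xs) ` C \<subseteq> {ys. set ys \<subseteq> ?Y \<and> length ys = length xs}"
      using xs by (intro image_subsetI) simp
  qed
  moreover have "\<exists>c\<in>C. \<exists>h\<in>pstab G \<Gamma>. g = c \<circ> h" if g: "g \<in> G" for g
  proof -
    obtain c where c: "c \<in> C" "map g xs = map c xs" using g C(3) by blast
    then have "c x = g x" if "x \<in> \<Gamma>" for x using that xs by auto
    then show ?thesis using coset_factorization[OF G _ g] c(1) C(1) by (metis subsetD)
  qed
  ultimately show ?thesis using that C(1) by blast
qed

fun word_balls :: "(nat \<Rightarrow> ('a \<Rightarrow> 'a) set) \<Rightarrow> nat \<Rightarrow> ('a \<Rightarrow> 'a) set" where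
  "word_balls S 0 = {id}"
| "word_balls S (Suc k) = comps (word_balls S k \<union> S k) (word_balls S k \<union> S k)"

lemma word_balls_symmetric:
  assumes S: "\<And>k f. f \<in> S k \<Longrightarrow> bij f \<and> inv f \<in> S k" and "f \<in> word_balls S k"
  shows "bij f \<and> inv f \<in> word_balls S k"
  using assms(2)
proof (induction k arbitrary: f)
  case (Suc k)
  then obtain g h where gh: "f = g \<circ> h" "g \<in> word_balls S k \<union> S k" "h \<in> word_balls S k \<union> S k"
    by (auto simp: comps_def)
  then have "bij g \<and> inv g \<in> word_balls S k \<union> S k" "bij h \<and> inv h \<in> word_balls S k \<union> S k"
    using Suc.IH S by blast+
  then show ?case
    unfolding gh(1) word_balls.simps comps_def
    by (auto intro: bij_comp simp: o_inv_distrib simp del: o_apply)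
qed simp

lemma word_balls_Suc_supset:
  assumes "id \<in> S k"
  shows "word_balls S k \<union> S k \<subseteq> word_balls S (Suc k)"
proof
  fix f assume "f \<in> word_balls S k \<union> S k"
  then have "f \<circ> id \<in> word_balls S (Suc k)"
    using assms unfolding word_balls.simps comps_def by blast
  then show "f \<in> word_balls S (Suc k)" by simp
qed

lemma gen_by_subset_word_balls:
  assumes S: "\<And>k f. f \<in> S k \<Longrightarrow> bij f \<and> inv f \<in> S k" and id: "\<And>k. id \<in> S k"
  shows "gen_by (\<Union>k. S k) \<subseteq> (\<Union>k. word_balls S k)"
proof
  have step: "word_balls S k \<union> S k \<subseteq> word_balls S (Suc k)" for k
    using id by (rule word_balls_Suc_supset)
  have mono: "word_balls S i \<subseteq> word_balls S j" if "i \<le> j" for i j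
    using step by (intro lift_Suc_mono_le[OF _ that]) blast
  fix f assume "f \<in> gen_by (\<Union>k. S k)"
  then show "f \<in> (\<Union>k. word_balls S k)"
  proof induction
    case gen_id
    have "id \<in> word_balls S 0" by simp
    then show ?case by blast
  next
    case (gen_base f)
    then show ?case using step by blast
  next
    case (gen_comp f g)
    then obtain i j where "f \<in> word_balls S i" "g \<in> word_balls S j" by blast
    then have "f \<in> word_balls S (max i j)" "g \<in> word_balls S (max i j)"
      using mono[of i "max i j"] mono[of j "max i j"] by auto
    then have "f \<circ> g \<in> word_balls S (Suc (max i j))" unfolding word_balls.simps comps_def by blast
    then show ?case by blast
  next
    case (gen_inv f)
    then show ?case using word_balls_symmetric[of S] S by blast
  qed
qed

context orbit_property
begin

lemma countably_covered_gen_by: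
  assumes P: "is_subgroup P" "Q P" and D: "countable D" "D \<subseteq> Sym"
  shows "countably_covered Q (gen_by (P \<union> D))"
proof -
  define d where "d = from_nat_into (insert id D)"
  have range_d: "range d = insert id D" unfolding d_def using D(1) by (intro range_from_nat_into) auto
  define S where "S k = P \<union> {d k, inv (d k)}" for k
  have "bij (d k)" for k
  proof -
    have "d k \<in> insert id D" using range_d by blast
    then show ?thesis using D(2) by (auto simp: Sym_def)
  qed
  then have "bij f \<and> inv f \<in> S k" if "f \<in> S k" for f k
    using that is_subgroupD(1,4)[OF P(1)] by (auto simp: S_def bij_imp_bij_inv inv_inv_eq)
  moreover have "id \<in> S k" for k using is_subgroupD(2)[OF P(1)] by (simp add: S_def)
  ultimately have "gen_by (\<Union>k. S k) \<subseteq> (\<Union>k. word_balls S k)" by (rule gen_by_subset_word_balls)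
  moreover have "P \<union> D \<subseteq> (\<Union>k. S k)" using range_d by (auto simp: S_def)
  ultimately have "gen_by (P \<union> D) \<subseteq> (\<Union>k. word_balls S k)" using gen_by_mono by blast
  moreover have "Q (S k)" for k unfolding S_def by (intro union P(2) finite) simp
  then have "Q (word_balls S k)" for k by (induction k) (simp_all add: finite union comps)
  ultimately show ?thesis unfolding countably_covered_def by blast
qed

lemma countably_covered_preceq:
  assumes G: "is_subgroup G" and Q: "some_pstab Q G" and le: "preceq X G"
  shows "countably_covered Q X"
proof -
  obtain \<Gamma> where \<Gamma>: "finite \<Gamma>" "Q (pstab G \<Gamma>)" using Q unfolding some_pstab_def by blast
  obtain U where U: "finite U" "U \<subseteq> Sym" "X \<subseteq> gen_by (G \<union> U)"
    using le unfolding preceq_def by blast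
  obtain C where C: "C \<subseteq> G" "countable C" "\<And>g. g \<in> G \<Longrightarrow> \<exists>c\<in>C. \<exists>h\<in>pstab G \<Gamma>. g = c \<circ> h"
    using coset_representatives[OF G \<Gamma>(1)] by metis
  let ?H = "gen_by (pstab G \<Gamma> \<union> (C \<union> U))"
  have "g \<in> ?H" if g: "g \<in> G" for g
  proof -
    obtain c h where "c \<in> C" "h \<in> pstab G \<Gamma>" "g = c \<circ> h" using C(3)[OF g] by blast
    then show ?thesis by (auto intro: gen_by.gen_comp gen_by.gen_base)
  qed
  then have "G \<union> U \<subseteq> ?H" by (auto intro: gen_by.gen_base)
  then have "X \<subseteq> ?H" using U(3) gen_by_subset by blast
  moreover have "countably_covered Q ?H"
  proof (rule countably_covered_gen_by)
    show "C \<union> U \<subseteq> Sym" using C(1) G U(2) by (auto simp: is_subgroup_def)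
    show "countable (C \<union> U)" using C(2) U(1) by (simp add: countable_finite)
  qed (fact is_subgroup_pstab[OF G] \<Gamma>(2))+
  ultimately show ?thesis unfolding countably_covered_def by blast
qed

end

lemma pointwise_limit_in_closed:
  assumes G: "is_subgroup G" "closed_in_Sym G" and g: "\<And>n. g n \<in> G"
    and \<Delta>: "\<And>n. \<Delta> n \<subseteq> \<Delta> (Suc n)" "(\<Union>n. \<Delta> n) = UNIV" "(\<Union>n. g n ` \<Delta> n) = UNIV"
    and agree: "\<And>n x. x \<in> \<Delta> n \<Longrightarrow> g (Suc n) x = g n x"
  obtains l where "l \<in> G" "\<And>n x. x \<in> \<Delta> n \<Longrightarrow> l x = g n x"
proof -
  have \<Delta>_mono: "\<Delta> m \<subseteq> \<Delta> n" if "m \<le> n" for m n using \<Delta>(1) that by (rule lift_Suc_mono_le)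
  then have \<Delta>_linear: "\<Delta> m \<subseteq> \<Delta> n \<or> \<Delta> n \<subseteq> \<Delta> m" for m n using nat_le_linear[of m n] by blast
  have stable: "g n x = g m x" if "m \<le> n" "x \<in> \<Delta> m" for m n x
    using that
  proof (induction n rule: dec_induct)
    case (step n)
    then show ?case using agree[of x n] \<Delta>_mono[OF step.hyps(1)] by auto
  qed simp
  define l where "l x = g (LEAST n. x \<in> \<Delta> n) x" for x
  have l: "l x = g n x" if "x \<in> \<Delta> n" for x n
    unfolding l_def by (rule stable[symmetric]) (use that in \<open>auto intro: Least_le LeastI\<close>)
  have bij_g: "bij (g n)" for n using is_subgroupD(1)[OF G(1) g] .
  have "bij_betw l (\<Union>n. \<Delta> n) (\<Union>n. g n ` \<Delta> n)"
  proof (rule bij_betw_UNION_chain)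
    show "\<Delta> m \<subseteq> \<Delta> n \<or> \<Delta> n \<subseteq> \<Delta> m" for m n by (rule \<Delta>_linear)
    have "bij_betw (g n) (\<Delta> n) (g n ` \<Delta> n)" for n
      using bij_g by (intro inj_on_imp_bij_betw) (auto intro: inj_on_subset bij_is_inj)
    then show "bij_betw l (\<Delta> n) (g n ` \<Delta> n)" for n by (simp add: l cong: bij_betw_cong)
  qed
  then have "l \<in> Sym" using \<Delta>(2,3) by (simp add: Sym_def)
  moreover have "\<exists>h\<in>G. \<forall>x\<in>F. h x = l x" if F: "finite F" for F
  proof -
    have "subset.chain UNIV (range \<Delta>)" using \<Delta>_linear by (auto simp: subset_chain_def)
    then obtain B where "B \<in> range \<Delta>" "F \<subseteq> B"
      using finite_subset_Union_chain[OF F, of "range \<Delta>" UNIV] \<Delta>(2) by auto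
    then obtain n where "F \<subseteq> \<Delta> n" by blast
    then have "\<forall>x\<in>F. g n x = l x" using l by auto
    then show ?thesis using g by blast
  qed
  ultimately have "l \<in> G" using G(2) unfolding closed_in_Sym_def by blast
  then show ?thesis using that l by blast
qed

lemma ex_escaping_extension:
  assumes G: "is_subgroup G" and g: "g \<in> G" and "\<not> finite_orbits (pstab G \<Gamma>)" and W: "finite_orbits W"
  obtains g' x where "g' \<in> G" "\<And>y. y \<in> \<Gamma> \<Longrightarrow> g' y = g y" "g' x \<notin> orbit_of W x"
proof -
  obtain x where x: "infinite (orbit_of (pstab G \<Gamma>) x)"
    using assms(3) unfolding finite_orbits_def by blast
  have "inj g" using is_subgroupD(1)[OF G g] by (rule bij_is_inj)
  then have "infinite (g ` orbit_of (pstab G \<Gamma>) x)"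
    using x by (metis finite_imageD inj_on_subset subset_UNIV)
  then have "\<not> g ` orbit_of (pstab G \<Gamma>) x \<subseteq> orbit_of W x"
    using W finite_subset unfolding finite_orbits_def by blast
  then obtain h where h: "h \<in> pstab G \<Gamma>" "g (h x) \<notin> orbit_of W x"
    unfolding orbit_of_eq_image[of "pstab G \<Gamma>"] by blast
  show ?thesis
  proof (rule that)
    show "g \<circ> h \<in> G" using g h(1) is_subgroupD(3)[OF G] by (simp add: pstab_def)
  qed (use h in \<open>simp_all add: pstab_def\<close>)
qed

text \<open>A Baire category argument.\<close>

lemma closed_covered_imp_some_pstab:
  fixes G :: "('a::countable \<Rightarrow> 'a) set"
  assumes G: "is_subgroup G" "closed_in_Sym G" and cover: "countably_covered finite_orbits G"
  shows "some_pstab finite_orbits G"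
proof (rule ccontr)
  assume contr: "\<not> ?thesis"
  obtain W :: "nat \<Rightarrow> ('a \<Rightarrow> 'a) set" where W: "G \<subseteq> (\<Union>k. W k)" "\<And>k. finite_orbits (W k)"
    using cover unfolding countably_covered_def by blast
  have "\<exists>s. \<forall>n. (fst (s n) \<in> G \<and> finite (snd (s n))) \<and>
      (snd (s n) \<subseteq> snd (s (Suc n)) \<and> (\<forall>x\<in>snd (s n). fst (s (Suc n)) x = fst (s n) x) \<and>
       from_nat n \<in> snd (s (Suc n)) \<and> from_nat n \<in> fst (s (Suc n)) ` snd (s (Suc n)) \<and>
       (\<exists>x\<in>snd (s (Suc n)). fst (s (Suc n)) x \<notin> orbit_of (W n) x))"
  proof (rule dependent_nat_choice)
    show "\<exists>s. fst s \<in> G \<and> finite (snd s)"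
      using is_subgroupD(2)[OF G(1)] by (intro exI[of _ "(id, {})"]) (simp del: id_apply)
    fix s :: "('a \<Rightarrow> 'a) \<times> 'a set" and n assume s: "fst s \<in> G \<and> finite (snd s)"
    then have "fst s \<in> G" "\<not> finite_orbits (pstab G (snd s))" using contr by (auto simp: some_pstab_def)
    then obtain g x where g: "g \<in> G" "\<And>y. y \<in> snd s \<Longrightarrow> g y = fst s y" "g x \<notin> orbit_of (W n) x"
      using ex_escaping_extension[OF G(1) _ _ W(2)] by blast
    obtain y where "from_nat n = g y" using is_subgroupD(1)[OF G(1) g(1)] by (metis bij_pointE)
    then show "\<exists>s'. (fst s' \<in> G \<and> finite (snd s')) \<and> (snd s \<subseteq> snd s' \<and> (\<forall>x\<in>snd s. fst s' x = fst s x) \<and>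
        from_nat n \<in> snd s' \<and> from_nat n \<in> fst s' ` snd s' \<and> (\<exists>x\<in>snd s'. fst s' x \<notin> orbit_of (W n) x))"
      using g s by (intro exI[of _ "(g, snd s \<union> {x, y, from_nat n})"]) (simp, blast)
  qed
  then obtain s where s: "\<And>n. fst (s n) \<in> G" "\<And>n. snd (s n) \<subseteq> snd (s (Suc n))"
      "\<And>n x. x \<in> snd (s n) \<Longrightarrow> fst (s (Suc n)) x = fst (s n) x"
      "\<And>n. from_nat n \<in> snd (s (Suc n))" "\<And>n. from_nat n \<in> fst (s (Suc n)) ` snd (s (Suc n))"
      "\<And>n. \<exists>x\<in>snd (s (Suc n)). fst (s (Suc n)) x \<notin> orbit_of (W n) x"
    by auto
  have "x \<in> (\<Union>n. snd (s n))" "x \<in> (\<Union>n. fst (s n) ` snd (s n))" for x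
    using s(4)[of "to_nat x"] s(5)[of "to_nat x"] by auto
  then have exhausting: "(\<Union>n. snd (s n)) = UNIV" "(\<Union>n. fst (s n) ` snd (s n)) = UNIV" by auto
  obtain l where l: "l \<in> G" "\<And>n x. x \<in> snd (s n) \<Longrightarrow> l x = fst (s n) x"
    using pointwise_limit_in_closed[where g = "\<lambda>n. fst (s n)" and \<Delta> = "\<lambda>n. snd (s n)", OF G s(1,2) exhausting s(3)]
    by blast
  obtain k where "l \<in> W k" using l(1) W(1) by blast
  then have "l x \<in> orbit_of (W k) x" for x by (auto simp: orbit_of_def)
  then show False using s(6)[of k] l(2)[of _ "Suc k"] by metis
qed

lemma unbounded_Sym_part_not_bounded_covered:
  fixes A :: "'a::countable set set"
  assumes A: "A \<in> unbounded_partitions"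
  shows "\<not> countably_covered bounded_orbits (Sym_part A)"
proof
  note partition = finite_block_partitionD[OF unbounded_partitionsD(1)[OF A]]
  assume "countably_covered bounded_orbits (Sym_part A)"
  then obtain W :: "nat \<Rightarrow> ('a \<Rightarrow> 'a) set" where cover: "Sym_part A \<subseteq> (\<Union>k. W k)" "\<And>k. bounded_orbits (W k)"
    unfolding countably_covered_def by blast
  then have "\<forall>k. \<exists>N. \<forall>x. finite (orbit_of (W k) x) \<and> card (orbit_of (W k) x) \<le> N"
    by (simp add: bounded_orbits_def)
  then obtain N where W: "\<And>k x. finite (orbit_of (W k) x)" "\<And>k x. card (orbit_of (W k) x) \<le> N k"
    by metis
  obtain C where C: "disjoint_family C" "\<And>k. C k \<in> A" "\<And>k. N k < card (C k)"
    using unbounded_family_choice[OF unbounded_partitionsD(2)[OF A], of N] by blast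
  have "\<exists>x y. x \<in> C k \<and> y \<in> C k \<and> y \<notin> orbit_of (W k) x" for k
  proof -
    obtain x where "x \<in> C k" using C(2) partition(4) by blast
    moreover have "\<not> C k \<subseteq> orbit_of (W k) x"
      using card_mono[OF W(1), of "C k" k x] W(2)[of k x] C(3)[of k] by linarith
    ultimately show ?thesis by blast
  qed
  then obtain x y where xy: "\<And>k. x k \<in> C k" "\<And>k. y k \<in> C k" "\<And>k. y k \<notin> orbit_of (W k) (x k)" by metis
  obtain u where u: "u permutes (\<Union>k. C k)" "\<And>k z. z \<in> C k \<Longrightarrow> u z = Transposition.transpose (x k) (y k) z"
      "\<And>k. u ` C k = C k"
    using glue_permutations[OF C(1), of "\<lambda>k. Transposition.transpose (x k) (y k)"] xy(1,2) by auto
  have "u \<in> Sym_blocks (range C)" using u(1,3) by (simp add: Sym_blocks_iff)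
  also have "\<dots> \<subseteq> Sym_blocks A" using partition(2) C(2) by (intro Sym_blocks_refine) auto
  finally obtain k where "u \<in> W k" using cover(1) partition(1) by (auto simp: Sym_blocks_eq_Sym_part)
  then have "u (x k) \<in> orbit_of (W k) (x k)" by (auto simp: orbit_of_def)
  then show False using u(2)[OF xy(1)[of k]] xy(3)[of k] by simp
qed

lemma finite_orbits_Sym_part:
  assumes "finite_block_partition A"
  shows "finite_orbits (Sym_part A)"
  unfolding finite_orbits_def
proof
  fix x
  obtain B where B: "B \<in> A" "x \<in> B" using finite_block_partitionD(1)[OF assms] by blast
  then have "orbit_of (Sym_part A) x \<subseteq> B" by (auto simp: orbit_of_def Sym_part_def)
  then show "finite (orbit_of (Sym_part A) x)"
    using finite_block_partitionD(3)[OF assms B(1)] by (rule finite_subset)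
qed


section \<open>Permutations almost preserving a chain of finite sets\<close>

lemma transpose_gen_by_trans:
  assumes ab: "Transposition.transpose a b \<in> gen_by X" and bc: "Transposition.transpose b c \<in> gen_by X"
  shows "Transposition.transpose a c \<in> gen_by X"
proof (cases "a = c \<or> b = c")
  case True
  then show ?thesis using ab gen_by.gen_id by auto
next
  case False
  then have "Transposition.transpose a c =
      Transposition.transpose a b \<circ> Transposition.transpose b c \<circ> Transposition.transpose a b"
    by (simp add: transpose_comp_triple)
  then show ?thesis using ab bc by (auto intro: gen_by.gen_comp)
qed

lemma gen_by_permutation:
  assumes transpose: "\<And>x y. Transposition.transpose x y \<in> gen_by X" and "permutation p"
  shows "p \<in> gen_by X"
proof -
  obtain S where "finite S" "p permutes S" using assms(2) by (rule permutation_permutesE)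
  from this(2,1) show ?thesis
    by (induction rule: permutes_induct) (intro gen_by.gen_id gen_by.gen_comp transpose; assumption)+
qed

lemma transpose_conjugate:
  assumes "bij v"
  shows "v \<circ> Transposition.transpose x y \<circ> inv v = Transposition.transpose (v x) (v y)"
proof -
  have "Transposition.transpose (v x) (v y) \<circ> v = v \<circ> Transposition.transpose x y"
    using assms by (simp add: transpose_comp_eq bij_is_inj)
  then show ?thesis by (simp only: comp_eq_iff_eq_comp_inv[OF assms])
qed

lemma transpose_in_gen_by_shift:
  fixes e :: "int \<Rightarrow> 'a"
  assumes v: "bij v" "v \<in> gen_by X" "\<And>i. v (e i) = e (i + 1)"
    and transpose_0_1: "Transposition.transpose (e 0) (e 1) \<in> gen_by X"
  shows "Transposition.transpose (e i) (e j) \<in> gen_by X"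
proof -
  let ?t = "\<lambda>i j. Transposition.transpose (e i) (e j)"
  have conj: "v \<circ> ?t i j \<circ> inv v = ?t (i + 1) (j + 1)" for i j
    by (simp only: transpose_conjugate[OF v(1)] v(3))
  have adjacent: "?t i (i + 1) \<in> gen_by X" for i
  proof (induction i rule: int_induct[where k = 0])
    case base
    show ?case using transpose_0_1 by simp
  next
    case (step1 i)
    then show ?case unfolding conj[symmetric] by (intro gen_by.gen_comp gen_by.gen_inv v(2))
  next
    case (step2 i)
    have shifted: "?t i (i + 1) = v \<circ> ?t (i - 1) i \<circ> inv v" using conj[of "i - 1" i] by simp
    have "?t (i - 1) i = inv v \<circ> (?t i (i + 1) \<circ> v)"
      unfolding shifted using v(1) by (simp add: fun_eq_iff bij_is_inj)
    also have "\<dots> \<in> gen_by X" by (intro gen_by.gen_comp gen_by.gen_inv v(2) step2.IH)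
    finally show ?case by (simp only: diff_add_cancel)
  qed
  have from_0: "?t 0 i \<in> gen_by X" for i
  proof (induction i rule: int_induct[where k = 0])
    case base
    show ?case using gen_by.gen_id by (simp del: id_apply)
  next
    case (step1 i)
    show ?case using step1.IH adjacent by (rule transpose_gen_by_trans)
  next
    case (step2 i)
    then show ?case
      using adjacent[of "i - 1"] by (auto simp: transpose_commute intro: transpose_gen_by_trans)
  qed
  have "?t i 0 \<in> gen_by X" by (subst transpose_commute) (rule from_0)
  then show ?thesis using from_0 by (rule transpose_gen_by_trans)
qed

text \<open>After identifying the points with the integers, a transposition of neighbours and a shift
  generate all finitary permutations.\<close>

lemma preceq_finitary_permutations:
  fixes H :: "('a::countable \<Rightarrow> 'a) set"
  assumes inf: "infinite (UNIV :: 'a set)"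
  shows "preceq (Collect permutation) H"
proof -
  obtain e :: "int \<Rightarrow> 'a" where e: "bij e"
    using bij_betw_trans[OF to_nat_on_infinite bij_betw_from_nat_into[OF countableI_type inf], of "UNIV :: int set"]
    by auto
  define v where "v = e \<circ> (\<lambda>i. i + 1) \<circ> inv e"
  have "bij (\<lambda>i :: int. i + 1)" by (rule o_bij[of "\<lambda>i. i - 1"]) (auto simp: fun_eq_iff)
  then have v: "bij v" using e unfolding v_def by (intro bij_comp bij_imp_bij_inv)
  let ?U = "{Transposition.transpose (e 0) (e 1), v}"
  have "Transposition.transpose (e i) (e j) \<in> gen_by ?U" for i j
  proof (rule transpose_in_gen_by_shift[OF v])
    show "v (e i) = e (i + 1)" for i using e by (simp add: v_def bij_is_inj)
  qed (simp_all add: gen_by.gen_base)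
  then have "Transposition.transpose x y \<in> gen_by ?U" for x y using e by (metis bij_pointE)
  then have "Collect permutation \<subseteq> gen_by ?U" using gen_by_permutation by blast
  moreover have "preceq ?U H" using v by (intro preceq_finite) (simp_all add: Sym_def)
  ultimately show ?thesis by (rule preceq_gen_by)
qed

lemma finite_block_partition_disjointed:
  assumes "\<And>n. finite (F n)" "(\<Union>n. F n) = UNIV"
  shows "finite_block_partition (range (disjointed F) - {{}})"
proof -
  have "finite (disjointed F n)" for n
    using disjointed_subset assms(1) by (rule finite_subset)
  moreover have "\<Union>(range (disjointed F) - {{}}) = \<Union>(range (disjointed F))" by blast
  then have "\<Union>(range (disjointed F) - {{}}) = UNIV" using UN_disjointed_eq[of F] assms(2) by simp
  moreover have "disjoint (range (disjointed F))"
    by (rule disjoint_family_on_disjoint_image[OF disjoint_family_disjointed])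
  then have "B \<inter> C = {}" if "B \<in> range (disjointed F)" "C \<in> range (disjointed F)" "B \<noteq> C" for B C
    using that by (rule disjointD)
  ultimately show ?thesis unfolding finite_block_partition_def by auto
qed

lemma Sym_part_range_subset_disjointed: "Sym_part (range F) \<subseteq> Sym_part (range (disjointed F) - {{}})"
proof
  fix f assume f: "f \<in> Sym_part (range F)"
  then have "inj f" "f ` F n = F n" for n by (auto simp: Sym_part_def Sym_def bij_is_inj)
  then have "f ` disjointed F n = disjointed F n" for n
    by (simp add: disjointed_def image_set_diff image_UN)
  then show "f \<in> Sym_part (range (disjointed F) - {{}})" using f by (auto simp: Sym_part_def)
qed

lemma Sym_part_range_preceq_Sym_part:
  fixes F :: "nat \<Rightarrow> 'a::countable set"
  assumes "infinite (UNIV :: 'a set)" "\<And>n. finite (F n)" "(\<Union>n. F n) = UNIV"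
    "A \<in> unbounded_partitions"
  shows "preceq (Sym_part (range F)) (Sym_part A)"
  using preceq_subset[OF Sym_part_range_subset_disjointed]
    Sym_part_preceq_Sym_part[OF assms(1) finite_block_partition_disjointed[OF assms(2,3)] assms(4)]
  by (rule preceq_trans)

lemma eventually_stabilizing_factor:
  assumes f: "bij f" "\<And>n. k \<le> n \<Longrightarrow> f ` F n = F n" and F: "\<And>n. F n \<subseteq> F (Suc n)" "\<And>n. finite (F n)"
  obtains \<sigma> e where "permutation \<sigma>" "e \<in> Sym_part (range F)" "f = \<sigma> \<circ> e"
proof
  have F_mono: "F m \<subseteq> F n" if "m \<le> n" for m n using F(1) that by (rule lift_Suc_mono_le)
  let ?\<sigma> = "restrict_id f (F k)"
  have "bij_betw f (F k) (F k)"
    using f(2)[of k] bij_is_inj[OF f(1)] by (auto intro: bij_betw_imageI inj_on_subset)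
  then have \<sigma>: "?\<sigma> permutes F k" by (rule permutes_restrict_id)
  then show "permutation ?\<sigma>" using F(2) permutes_imp_permutation by blast
  show "f = ?\<sigma> \<circ> (inv ?\<sigma> \<circ> f)" using \<sigma> by (simp add: fun_eq_iff permutes_inverses)
  have "(inv ?\<sigma> \<circ> f) ` F n = F n" for n
  proof (cases "k \<le> n")
    case True
    from permutes_inv[OF permutes_subset[OF \<sigma> F_mono[OF True]]] have "inv ?\<sigma> permutes F n" .
    then show ?thesis unfolding image_comp[symmetric] f(2)[OF True] by (rule permutes_image)
  next
    case False
    have "(inv ?\<sigma> \<circ> f) x = x" if "x \<in> F n" for x
    proof -
      have "f x = ?\<sigma> x" using that F_mono[of n k] False by auto
      then show ?thesis using \<sigma> by (simp add: permutes_inverses)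
    qed
    then show ?thesis by simp
  qed
  moreover have "bij (inv ?\<sigma> \<circ> f)" using f(1) permutes_bij[OF permutes_inv[OF \<sigma>]] by (rule bij_comp)
  ultimately show "inv ?\<sigma> \<circ> f \<in> Sym_part (range F)" by (auto simp: Sym_part_def Sym_def)
qed

lemma ex_bij_betw_image_eq:
  assumes "finite X" "A \<subseteq> X" "B \<subseteq> X" "card A = card B"
  shows "\<exists>\<rho>. bij_betw \<rho> X X \<and> \<rho> ` A = B"
proof -
  have fin: "finite A" "finite B" using assms finite_subset by auto
  obtain p where p: "bij_betw p A B"
    using finite_same_card_bij[OF fin assms(4)] by blast
  have "card (X - A) = card (X - B)" using assms fin by (simp add: card_Diff_subset)
  then obtain q where q: "bij_betw q (X - A) (X - B)"
    using finite_same_card_bij[of "X - A" "X - B"] assms(1) by auto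
  let ?\<rho> = "\<lambda>x. if x \<in> A then p x else q x"
  have "bij_betw ?\<rho> (A \<union> (X - A)) (B \<union> (X - B))" using p q by (rule bij_betw_disjoint_Un) auto
  moreover have "A \<union> (X - A) = X" "B \<union> (X - B) = X" using assms(2,3) by auto
  moreover have "?\<rho> ` A = B" using bij_betw_imp_surj_on[OF p] by simp
  ultimately show ?thesis by auto
qed

lemma ex_bij_betw_layer:
  assumes "finite B'" "B \<subseteq> A" "A \<subseteq> B'" "B \<subseteq> A'" "A' \<subseteq> B'" "card A = card A'"
  shows "\<exists>\<rho>. bij_betw \<rho> (B' - B) (B' - B) \<and> \<rho> ` (A - B) = A' - B"
proof (rule ex_bij_betw_image_eq)
  have "finite B" by (rule finite_subset[OF order_trans[OF assms(2,3)] assms(1)])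
  then show "card (A - B) = card (A' - B)" using assms(2,4,6) by (simp add: card_Diff_subset)
  show "A - B \<subseteq> B' - B" "A' - B \<subseteq> B' - B" using assms(3,5) by blast+
qed (simp add: assms(1))

lemma image_eq_of_disjointed:
  assumes "mono B" and "\<And>n. h ` disjointed B n = disjointed B n"
  shows "h ` B n = B n"
proof -
  have "B n = (\<Union>i\<in>{0..<Suc n}. disjointed B i)"
    using mono_imp_UN_eq_last[OF assms(1), of n] finite_UN_disjointed_eq[of B "Suc n"]
    by (simp add: atLeast0LessThan lessThan_Suc_atMost)
  then show ?thesis using assms(2) by (simp only: image_UN)
qed

text \<open>Since the sets are finite, \<open>inv g\<close> moves as many points across the level \<open>A (Suc j)\<close> upwards as
  downwards, all of them between \<open>B j\<close> and \<open>B (Suc j)\<close>; permuting these layers undoes the crossings.\<close>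

lemma ex_level_correction:
  assumes B: "\<And>j. finite (B j)" and chain: "\<And>j. B j \<subseteq> A (Suc j)" "\<And>j. A (Suc j) \<subseteq> B (Suc j)"
    and g: "bij g" "\<And>j. k \<le> j \<Longrightarrow> B j \<subseteq> inv g ` A (Suc j)" "\<And>j. k \<le> j \<Longrightarrow> inv g ` A (Suc j) \<subseteq> B (Suc j)"
  obtains h where "h \<in> Sym_part (range B)" "\<And>j. k \<le> j \<Longrightarrow> (g \<circ> h) ` A (Suc j) = A (Suc j)"
proof -
  have "B j \<subseteq> B (Suc j)" for j using chain by blast
  then have "mono B" by (simp add: mono_iff_le_Suc)
  let ?T = "disjointed B"
  have T_Suc: "?T (Suc j) = B (Suc j) - B j" for j using \<open>mono B\<close> by (rule disjointed_mono)
  have card_inv: "card (inv g ` X) = card X" for X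
    using bij_imp_bij_inv[OF g(1)] by (intro card_image) (auto intro: inj_on_subset bij_is_inj)
  have layer: "\<exists>\<rho>. bij_betw \<rho> (?T (Suc j)) (?T (Suc j)) \<and> \<rho> ` (A (Suc j) - B j) = inv g ` A (Suc j) - B j"
    if "k \<le> j" for j
    unfolding T_Suc
    by (rule ex_bij_betw_layer[OF B chain(1,2)[of j] g(2,3)[OF that] card_inv[symmetric]])
  have "\<exists>\<rho>. bij_betw \<rho> (?T i) (?T i) \<and>
      (\<forall>j\<ge>k. i = Suc j \<longrightarrow> \<rho> ` (A (Suc j) - B j) = inv g ` A (Suc j) - B j)" for i
  proof (cases "\<exists>j\<ge>k. i = Suc j")
    case True
    then show ?thesis using layer by auto
  next
    case False
    then show ?thesis by (intro exI[of _ id]) auto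
  qed
  then obtain \<rho> where \<rho>: "\<And>i. bij_betw (\<rho> i) (?T i) (?T i)"
      "\<And>j. k \<le> j \<Longrightarrow> \<rho> (Suc j) ` (A (Suc j) - B j) = inv g ` A (Suc j) - B j"
    by metis
  obtain h where h: "h permutes (\<Union>i. ?T i)" "\<And>i x. x \<in> ?T i \<Longrightarrow> h x = \<rho> i x" "\<And>i. h ` ?T i = ?T i"
    using glue_permutations[OF disjoint_family_disjointed \<rho>(1)] by auto
  have h_B: "h ` B n = B n" for n using \<open>mono B\<close> h(3) by (rule image_eq_of_disjointed)
  have "(g \<circ> h) ` A (Suc j) = A (Suc j)" if j: "k \<le> j" for j
  proof -
    have "h ` (A (Suc j) - B j) = \<rho> (Suc j) ` (A (Suc j) - B j)"
      using chain(2)[of j] by (intro image_cong h(2)) (auto simp: T_Suc)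
    then have "h ` (B j \<union> (A (Suc j) - B j)) = B j \<union> (inv g ` A (Suc j) - B j)"
      unfolding image_Un h_B \<rho>(2)[OF j] by simp
    then have h_A: "h ` A (Suc j) = inv g ` A (Suc j)"
      using chain(1)[of j] g(2)[OF j] by (simp add: Un_absorb1)
    show ?thesis unfolding image_comp[symmetric] h_A by (rule image_f_inv_f[OF bij_is_surj[OF g(1)]])
  qed
  moreover have "h \<in> Sym_part (range B)"
    using permutes_bij[OF h(1)] h_B by (auto simp: Sym_part_def Sym_def)
  ultimately show ?thesis using that by blast
qed

lemma almost_preserving_chain_in_gen_by:
  fixes F :: "nat \<Rightarrow> 'a set"
  assumes F: "\<And>n. finite (F n)" "\<And>n. F n \<subseteq> F (Suc n)"
    and g: "bij g" "\<And>n. k \<le> n \<Longrightarrow> g ` F n \<subseteq> F (Suc n)" "\<And>n. k \<le> n \<Longrightarrow> inv g ` F n \<subseteq> F (Suc n)"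
  shows "g \<in> gen_by (Collect permutation \<union>
    (Sym_part (range (\<lambda>j. F (2 * j))) \<union> Sym_part (range (\<lambda>j. F (Suc (2 * j))))))"
proof -
  have inv_image: "F n \<subseteq> inv g ` F (Suc n)" if "k \<le> n" for n
    using image_mono[OF g(2)[OF that], of "inv g"] g(1) by (simp add: image_comp bij_is_inj)
  have interleaved: "F (Suc (2 * j)) \<subseteq> F (2 * Suc j)" "F (2 * Suc j) \<subseteq> F (Suc (2 * Suc j))" for j
    using F(2)[of "Suc (2 * j)"] F(2)[of "2 * Suc j"] by simp_all
  have inv_between: "F (Suc (2 * j)) \<subseteq> inv g ` F (2 * Suc j)"
      "inv g ` F (2 * Suc j) \<subseteq> F (Suc (2 * Suc j))" if "k \<le> j" for j
    using inv_image[of "Suc (2 * j)"] g(3)[of "2 * Suc j"] that by simp_all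
  obtain h where h: "h \<in> Sym_part (range (\<lambda>j. F (Suc (2 * j))))"
      "\<And>j. k \<le> j \<Longrightarrow> (g \<circ> h) ` F (2 * Suc j) = F (2 * Suc j)"
    by (rule ex_level_correction[of "\<lambda>j. F (Suc (2 * j))" "\<lambda>j. F (2 * j)",
          OF F(1) interleaved g(1) inv_between]; blast)
  have bij_h: "bij h" using h(1) by (simp add: Sym_part_def Sym_def)
  have "(g \<circ> h) ` F (2 * j) = F (2 * j)" if "Suc k \<le> j" for j
    using h(2)[of "j - 1"] that by simp
  moreover have "F (2 * j) \<subseteq> F (2 * Suc j)" for j using F(2)[of "2 * j"] F(2)[of "Suc (2 * j)"] by auto
  ultimately obtain \<sigma> e where "permutation \<sigma>" "e \<in> Sym_part (range (\<lambda>j. F (2 * j)))" "g \<circ> h = \<sigma> \<circ> e"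
    using eventually_stabilizing_factor[OF bij_comp[OF bij_h g(1)], of "Suc k" "\<lambda>j. F (2 * j)"] F(1) by blast
  moreover from this have "g = \<sigma> \<circ> e \<circ> inv h" by (simp only: comp_eq_iff_eq_comp_inv[OF bij_h])
  ultimately show ?thesis
    using h(1) by (auto intro!: gen_by.gen_comp gen_by.gen_inv intro: gen_by.gen_base)
qed

lemma finite_orbits_covered_imp_preceq_Sym_part:
  fixes G :: "('a::countable \<Rightarrow> 'a) set"
  assumes inf: "infinite (UNIV :: 'a set)" and G: "is_subgroup G"
    and cover: "countably_covered finite_orbits G" and A: "A \<in> unbounded_partitions"
  shows "preceq G (Sym_part A)"
proof -
  obtain W :: "nat \<Rightarrow> ('a \<Rightarrow> 'a) set" where W: "G \<subseteq> (\<Union>k. W k)" "\<And>k. finite_orbits (W k)"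
    using cover unfolding countably_covered_def by blast
  define F where "F = rec_nat {} (\<lambda>n X. insert (from_nat n) X \<union> (\<Union>i\<le>n. \<Union>x\<in>X. orbit_of (W i) x))"
  have F_Suc: "F (Suc n) = insert (from_nat n) (F n) \<union> (\<Union>i\<le>n. \<Union>x\<in>F n. orbit_of (W i) x)" for n
    by (simp add: F_def)
  have fin: "finite (F n)" for n
    by (induction n) (use W(2) in \<open>simp_all add: F_def finite_orbits_def\<close>)
  have F_chain: "F n \<subseteq> F (Suc n)" for n unfolding F_Suc by blast
  then have F_mono: "F m \<subseteq> F n" if "m \<le> n" for m n using that by (rule lift_Suc_mono_le)
  have F_cover: "x \<in> F (Suc (to_nat x))" for x unfolding F_Suc by simp
  have image_F: "h ` F n \<subseteq> F (Suc n)" if "h \<in> W i" "i \<le> n" for h i n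
    using that unfolding F_Suc orbit_of_def by blast
  let ?E = "\<lambda>j. F (2 * j)" and ?O = "\<lambda>j. F (Suc (2 * j))"
  have "G \<subseteq> gen_by (Collect permutation \<union> (Sym_part (range ?E) \<union> Sym_part (range ?O)))"
  proof
    fix g assume g: "g \<in> G"
    then obtain i j where W_ij: "g \<in> W i" "inv g \<in> W j" using W(1) is_subgroupD(4)[OF G g] by blast
    have step: "g ` F n \<subseteq> F (Suc n)" "inv g ` F n \<subseteq> F (Suc n)" if "max i j \<le> n" for n
      using image_F[OF W_ij(1), of n] image_F[OF W_ij(2), of n] that by auto
    show "g \<in> gen_by (Collect permutation \<union> (Sym_part (range ?E) \<union> Sym_part (range ?O)))"
      by (rule almost_preserving_chain_in_gen_by[where F = F, OF fin F_chain is_subgroupD(1)[OF G g] step])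
  qed
  moreover have "x \<in> ?E (Suc (to_nat x))" "x \<in> ?O (Suc (to_nat x))" for x
    using F_cover F_mono[of "Suc (to_nat x)" "2 * Suc (to_nat x)"]
      F_mono[of "Suc (to_nat x)" "Suc (2 * Suc (to_nat x))"] by auto
  then have E_cover: "(\<Union>j. ?E j) = UNIV" and O_cover: "(\<Union>j. ?O j) = UNIV" by blast+
  note levels_preceq = Sym_part_range_preceq_Sym_part[OF inf fin E_cover A]
    Sym_part_range_preceq_Sym_part[OF inf fin O_cover A]
  ultimately show ?thesis
    using preceq_Un[OF preceq_finitary_permutations[OF inf] preceq_Un[OF levels_preceq]]
    by (intro preceq_gen_by[of G])
qed


section \<open>Encoding all permutations of infinitely many finite sets\<close>

definition avoidable :: "('a \<Rightarrow> 'a) set \<Rightarrow> 'a set \<Rightarrow> nat \<Rightarrow> bool" where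
  "avoidable H Z N \<longleftrightarrow> (\<forall>W. finite W \<longrightarrow> card W \<le> N \<longrightarrow> (\<exists>h\<in>H. h ` Z \<inter> W = {}))"

lemma avoidableD:
  assumes "avoidable H Z N" "finite W" "card W \<le> N"
  obtains h where "h \<in> H" "h ` Z \<inter> W = {}"
  using assms unfolding avoidable_def by blast

lemma avoidable_insert:
  assumes H: "is_subgroup H" and Z: "avoidable H Z N" and x: "N < card (orbit_of (pstab H Z) x)"
  shows "avoidable H (insert x Z) N"
  unfolding avoidable_def
proof (intro allI impI)
  fix W :: "'a set" assume W: "finite W" "card W \<le> N"
  obtain h where h: "h \<in> H" "h ` Z \<inter> W = {}" using Z W by (rule avoidableD)
  have bij_h: "bij h" using is_subgroupD(1)[OF H h(1)] .
  have "card (inv h ` W) < card (orbit_of (pstab H Z) x)"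
    using card_image_le[OF W(1), of "inv h"] W(2) x by linarith
  then have "\<not> orbit_of (pstab H Z) x \<subseteq> inv h ` W"
    using card_mono[OF finite_imageI[OF W(1)], of "orbit_of (pstab H Z) x" "inv h"] by linarith
  then obtain k where k: "k \<in> pstab H Z" "k x \<notin> inv h ` W" by (auto simp: orbit_of_def)
  have "h (k x) \<notin> W"
    using k(2) imageI[of "h (k x)" W "inv h"] bij_h by (auto simp: bij_is_inj)
  moreover have "h (k z) \<notin> W" if "z \<in> Z" for z using k(1) h(2) that by (auto simp: pstab_def)
  ultimately have "(h \<circ> k) ` insert x Z \<inter> W = {}" by auto
  moreover have "h \<circ> k \<in> H" using h(1) k(1) is_subgroupD(3)[OF H] by (simp add: pstab_def)
  ultimately show "\<exists>h\<in>H. h ` insert x Z \<inter> W = {}" by blast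
qed

lemma ex_avoidable:
  assumes H: "is_subgroup H" and finite: "finite_orbits H"
    and unbounded: "\<not> some_pstab bounded_orbits H"
  shows "\<exists>Z. finite Z \<and> card Z = m \<and> avoidable H Z N"
proof (induction m)
  case 0
  show ?case using is_subgroupD(2)[OF H] by (intro exI[of _ "{}"]) (auto simp: avoidable_def)
next
  case (Suc m)
  then obtain Z where Z: "finite Z" "card Z = m" "avoidable H Z N" by blast
  have "finite_orbits (pstab H Z)" using finite pstab_subset by (rule finite_orbits_subset)
  moreover have "\<not> bounded_orbits (pstab H Z)" using unbounded Z(1) by (auto simp: some_pstab_def)
  ultimately obtain x where x: "max 1 N < card (orbit_of (pstab H Z) x)"
    using unbounded_orbitsD[of "pstab H Z" "max 1 N"] by blast
  have "x \<notin> Z"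
  proof
    assume "x \<in> Z"
    then have "orbit_of (pstab H Z) x \<subseteq> {x}" unfolding orbit_of_def pstab_def by blast
    then have "card (orbit_of (pstab H Z) x) \<le> 1" using card_mono[of "{x}"] by simp
    then show False using x by simp
  qed
  moreover have "avoidable H (insert x Z) N" using H Z(3) x by (intro avoidable_insert) auto
  ultimately show ?case using Z(1,2) by (intro exI[of _ "insert x Z"]) simp
qed

lemma disjoint_translates:
  fixes c :: "'i \<Rightarrow> 'a \<Rightarrow> 'a"
  assumes "finite I" "\<And>i. i \<in> I \<Longrightarrow> bij (c i)" and Z: "finite Z" "avoidable P Z N"
    and "card I * card Z \<le> N"
  shows "\<exists>h. (\<forall>i\<in>I. h i \<in> P) \<and> disjoint_family_on (\<lambda>i. c i ` h i ` Z) I"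
  using assms(1,2,5)
proof (induction I)
  case empty
  then show ?case by (simp add: disjoint_family_on_def)
next
  case (insert i I)
  then have "\<exists>h. (\<forall>j\<in>I. h j \<in> P) \<and> disjoint_family_on (\<lambda>j. c j ` h j ` Z) I" by simp
  then obtain h where h: "\<And>j. j \<in> I \<Longrightarrow> h j \<in> P" "disjoint_family_on (\<lambda>j. c j ` h j ` Z) I"
    by blast
  define W where "W = (\<Union>j\<in>I. c j ` h j ` Z)"
  have W: "finite W" using Z(1) insert.hyps(1) by (simp add: W_def)
  have "card (c j ` h j ` Z) \<le> card Z" for j
    by (rule order_trans[OF card_image_le card_image_le]) (simp_all add: Z(1))
  then have "card W \<le> card I * card Z"
    unfolding W_def using sum_bounded_above[of I "\<lambda>j. card (c j ` h j ` Z)" "card Z"]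
    by (intro order_trans[OF card_UN_le[OF insert.hyps(1)]]) simp
  also have "\<dots> \<le> N" using insert.prems(2) insert.hyps by simp
  finally have "card (inv (c i) ` W) \<le> N" using card_image_le[OF W, of "inv (c i)"] by linarith
  then obtain k where k: "k \<in> P" "k ` Z \<inter> inv (c i) ` W = {}"
    using avoidableD[OF Z(2) finite_imageI[OF W]] by blast
  have "c i (k z) \<notin> W" if "z \<in> Z" for z
    using k(2) that imageI[of "c i (k z)" W "inv (c i)"] insert.prems(1)[of i] by (auto simp: bij_is_inj)
  then have avoids: "c i ` k ` Z \<inter> W = {}" by blast
  let ?h = "h(i := k)"
  have h_eq: "(\<Union>j\<in>I. c j ` ?h j ` Z) = W" "disjoint_family_on (\<lambda>j. c j ` ?h j ` Z) I"
    using insert.hyps(2) h(2) unfolding W_def disjoint_family_on_def by (auto cong: SUP_cong)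
  have "disjoint_family_on (\<lambda>j. c j ` ?h j ` Z) (insert i I)"
    unfolding disjoint_family_on_insert[OF insert.hyps(2)] using avoids h_eq by simp
  then show ?case using h(1) k(1) by (intro exI[of _ ?h]) auto
qed

definition intertwiner_on :: "'a set \<Rightarrow> ('a \<Rightarrow> 'a) \<Rightarrow> ('a \<Rightarrow> 'a) \<Rightarrow> ('a \<Rightarrow> 'a) \<Rightarrow> bool" where
  "intertwiner_on Z g q p \<longleftrightarrow> (\<forall>z\<in>Z. p (g z) = g (q z))"

lemma ex_permutation_intertwined_on_translates:
  assumes disjoint: "disjoint_family_on (\<lambda>i. g i ` Z) I"
    and g: "\<And>i. i \<in> I \<Longrightarrow> inj_on (g i) Z" and q: "\<And>i. i \<in> I \<Longrightarrow> q i permutes Z"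
  obtains p where "p permutes (\<Union>i\<in>I. g i ` Z)" "\<And>i. i \<in> I \<Longrightarrow> intertwiner_on Z (g i) (q i) p"
proof -
  define \<rho> where "\<rho> i = map_permutation Z (g i) (q i)" for i
  have "bij_betw (\<rho> i) (g i ` Z) (g i ` Z)" if "i \<in> I" for i
    unfolding \<rho>_def
    by (rule permutes_imp_bij[OF map_permutation_permutes[OF inj_on_imp_bij_betw[OF g[OF that]] q[OF that]]])
  then obtain p where p: "p permutes (\<Union>i\<in>I. g i ` Z)"
    "\<And>i x. i \<in> I \<Longrightarrow> x \<in> g i ` Z \<Longrightarrow> p x = \<rho> i x"
    by (rule glue_permutations[OF disjoint]; blast)
  have "intertwiner_on Z (g i) (q i) p" if "i \<in> I" for i
    unfolding intertwiner_on_def using p(2)[OF that] map_permutation_apply[OF g[OF that]]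
    by (simp add: \<rho>_def)
  then show ?thesis using that p(1) by blast
qed

lemma ex_encoding_permutation:
  assumes C: "finite C" "C \<subseteq> Sym" and P: "P \<subseteq> Sym"
    and Z: "finite Z" "avoidable P Z N" "card C * fact (card Z) * card Z \<le> N"
  obtains p V where "finite V" "V \<subseteq> (\<Union>c\<in>C. \<Union>h\<in>P. (c \<circ> h) ` Z)" "p permutes V"
    "\<And>c q. c \<in> C \<Longrightarrow> q permutes Z \<Longrightarrow> \<exists>h\<in>P. intertwiner_on Z (c \<circ> h) q p"
proof -
  define I where "I = C \<times> {q. q permutes Z}"
  have I: "finite I" "card I = card C * fact (card Z)"
    using C(1) Z(1) by (simp_all add: I_def finite_permutations card_cartesian_product card_permutations)
  have "\<exists>h. (\<forall>i\<in>I. h i \<in> P) \<and> disjoint_family_on (\<lambda>i. fst i ` h i ` Z) I"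
  proof (rule disjoint_translates[OF I(1) _ Z(1,2)])
    show "bij (fst i)" if "i \<in> I" for i using that C(2) by (auto simp: I_def Sym_def)
  qed (simp add: I(2) Z(3))
  then obtain h where h: "\<And>i. i \<in> I \<Longrightarrow> h i \<in> P"
    and disjoint: "disjoint_family_on (\<lambda>i. (fst i \<circ> h i) ` Z) I"
    unfolding image_comp by blast
  have inj: "inj_on (fst i \<circ> h i) Z" if "i \<in> I" for i
  proof -
    have "bij (fst i)" "bij (h i)" using that h[OF that] C(2) P by (auto simp: I_def Sym_def)
    then show ?thesis by (intro inj_on_subset[OF bij_is_inj[OF bij_comp]]) auto
  qed
  have snd_permutes: "snd i permutes Z" if "i \<in> I" for i using that by (auto simp: I_def)
  obtain p where p: "p permutes (\<Union>i\<in>I. (fst i \<circ> h i) ` Z)"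
    "\<And>i. i \<in> I \<Longrightarrow> intertwiner_on Z (fst i \<circ> h i) (snd i) p"
    using ex_permutation_intertwined_on_translates[OF disjoint, of snd] inj snd_permutes by blast
  show ?thesis
  proof (rule that[OF _ _ p(1)])
    show "(\<Union>i\<in>I. (fst i \<circ> h i) ` Z) \<subseteq> (\<Union>c\<in>C. \<Union>h\<in>P. (c \<circ> h) ` Z)"
      using h by (fastforce simp: I_def)
    show "\<exists>h\<in>P. intertwiner_on Z (c \<circ> h) q p" if "c \<in> C" "q permutes Z" for c q
      using p(2)[of "(c, q)"] h[of "(c, q)"] that by (auto simp: I_def)
  qed (use I(1) Z(1) in simp)
qed

definition invariant_under :: "('a \<Rightarrow> 'a) set \<Rightarrow> 'a set \<Rightarrow> bool" where
  "invariant_under G \<Delta> \<longleftrightarrow> (\<forall>g\<in>G. g ` \<Delta> = \<Delta>)"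

lemma invariant_under_orbits:
  assumes G: "is_subgroup G"
  shows "invariant_under G (\<Union>x\<in>X. orbit_of G x)" (is "invariant_under G ?Y")
proof -
  have image_subset: "g ` ?Y \<subseteq> ?Y" if g: "g \<in> G" for g
  proof (rule image_subsetI)
    fix y assume "y \<in> ?Y"
    then obtain x h where xh: "x \<in> X" "h \<in> G" "y = h x" unfolding orbit_of_def by blast
    have "g \<circ> h \<in> G" using g xh(2) by (rule is_subgroupD(3)[OF G])
    then have "(g \<circ> h) x \<in> orbit_of G x" unfolding orbit_of_def by blast
    then show "g y \<in> ?Y" using xh(1,3) by auto
  qed
  have "?Y \<subseteq> g ` ?Y" if g: "g \<in> G" for g
  proof -
    have "?Y = g ` inv g ` ?Y" using image_f_inv_f[OF bij_is_surj[OF is_subgroupD(1)[OF G g]]] ..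
    also have "\<dots> \<subseteq> g ` ?Y" by (rule image_mono[OF image_subset[OF is_subgroupD(4)[OF G g]]])
    finally show ?thesis .
  qed
  then show ?thesis using image_subset by (simp add: invariant_under_def subset_antisym)
qed

lemma ex_finite_invariant_superset:
  assumes G: "is_subgroup G" "finite_orbits G" and X: "finite X"
  obtains \<Delta> where "finite \<Delta>" "invariant_under G \<Delta>" "X \<subseteq> \<Delta>"
proof (rule that)
  show "finite (\<Union>x\<in>X. orbit_of G x)" using G(2) X by (simp add: finite_orbits_def)
  show "invariant_under G (\<Union>x\<in>X. orbit_of G x)" using G(1) by (rule invariant_under_orbits)
  have "id x \<in> orbit_of G x" for x using is_subgroupD(2)[OF G(1)] unfolding orbit_of_def by blast
  then show "X \<subseteq> (\<Union>x\<in>X. orbit_of G x)" by auto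
qed

lemma invariant_under_image_disjoint:
  assumes "is_subgroup G" "invariant_under G \<Delta>" "g \<in> G" "Z \<inter> \<Delta> = {}"
  shows "g ` Z \<inter> \<Delta> = {}"
proof -
  have "g ` Z \<inter> \<Delta> = g ` Z \<inter> g ` \<Delta>" using assms(2,3) by (simp add: invariant_under_def)
  also have "\<dots> = {}"
    using assms(4) bij_is_inj[OF is_subgroupD(1)[OF assms(1,3)]] by (metis image_Int image_empty)
  finally show ?thesis .
qed

definition encodes_on_cosets :: "('a \<Rightarrow> 'a) set \<Rightarrow> 'a set \<Rightarrow> 'a set \<Rightarrow> ('a \<Rightarrow> 'a) \<Rightarrow> bool" where
  "encodes_on_cosets G \<Delta> Z p \<longleftrightarrow>
    (\<forall>c\<in>G. \<forall>q. q permutes Z \<longrightarrow> (\<exists>h\<in>pstab G \<Delta>. intertwiner_on Z (c \<circ> h) q p))"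

lemma encodes_on_cosets_if_representatives:
  assumes G: "is_subgroup G"
    and C: "\<And>g. g \<in> G \<Longrightarrow> \<exists>c\<in>C. \<exists>k\<in>pstab G \<Delta>. g = c \<circ> k"
      "\<And>c q. c \<in> C \<Longrightarrow> q permutes Z \<Longrightarrow> \<exists>h\<in>pstab G \<Delta>. intertwiner_on Z (c \<circ> h) q p"
  shows "encodes_on_cosets G \<Delta> Z p"
  unfolding encodes_on_cosets_def
proof (intro ballI allI impI)
  note P = is_subgroup_pstab[OF G, of \<Delta>]
  fix g q assume g: "g \<in> G" and q: "q permutes Z"
  obtain c k where ck: "c \<in> C" "k \<in> pstab G \<Delta>" "g = c \<circ> k" using C(1)[OF g] by blast
  obtain h where h: "h \<in> pstab G \<Delta>" "intertwiner_on Z (c \<circ> h) q p" using C(2)[OF ck(1) q] by blast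
  have "g \<circ> (inv k \<circ> h) = c \<circ> h"
    using is_subgroupD(1)[OF P ck(2)] by (simp add: ck(3) fun_eq_iff bij_is_surj surj_f_inv_f)
  moreover have "inv k \<circ> h \<in> pstab G \<Delta>" using ck(2) h(1) is_subgroupD(3,4)[OF P] by blast
  ultimately show "\<exists>h\<in>pstab G \<Delta>. intertwiner_on Z (g \<circ> h) q p" using h(2) by metis
qed

lemma ex_encoding_step:
  fixes G :: "('a::countable \<Rightarrow> 'a) set"
  assumes G: "is_subgroup G" and finite: "finite_orbits G"
    and unbounded: "\<not> some_pstab bounded_orbits G"
    and \<Delta>: "finite \<Delta>" "invariant_under G \<Delta>"
  obtains Z V p where "finite Z" "card Z = m" "Z \<inter> \<Delta> = {}" "finite V" "V \<inter> \<Delta> = {}" "p permutes V"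
    "encodes_on_cosets G \<Delta> Z p"
proof -
  let ?P = "pstab G \<Delta>"
  have P: "is_subgroup ?P" using G by (rule is_subgroup_pstab)
  obtain C where C: "finite C" "C \<subseteq> G" "\<And>g. g \<in> G \<Longrightarrow> \<exists>c\<in>C. \<exists>k\<in>?P. g = c \<circ> k"
    using coset_representatives[OF G \<Delta>(1)] finite by metis
  define N where "N = card \<Delta> + card C * fact m * m"
  have "\<not> some_pstab bounded_orbits ?P" using unbounded \<Delta>(1) some_pstab_pstab by blast
  then obtain Z where Z: "finite Z" "card Z = m" "avoidable ?P Z N"
    using ex_avoidable[OF P finite_orbits_subset[OF finite pstab_subset]] by blast
  obtain h where "h \<in> ?P" "h ` Z \<inter> \<Delta> = {}"
    using avoidableD[OF Z(3) \<Delta>(1)] by (auto simp: N_def)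
  then have Z_\<Delta>: "Z \<inter> \<Delta> = {}" by (force simp: pstab_def)
  have perms: "C \<subseteq> Sym" "?P \<subseteq> Sym" using C(2) G P by (auto simp: is_subgroup_def)
  have N: "card C * fact (card Z) * card Z \<le> N" by (simp add: N_def Z(2))
  obtain p V where V: "finite V" "V \<subseteq> (\<Union>c\<in>C. \<Union>h\<in>?P. (c \<circ> h) ` Z)" "p permutes V"
    "\<And>c q. c \<in> C \<Longrightarrow> q permutes Z \<Longrightarrow> \<exists>h\<in>?P. intertwiner_on Z (c \<circ> h) q p"
    by (rule ex_encoding_permutation[OF C(1) perms Z(1,3) N]) (rule that)
  have "(c \<circ> h) ` Z \<inter> \<Delta> = {}" if "c \<in> C" "h \<in> ?P" for c h
    using G \<Delta>(2) _ Z_\<Delta>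
  proof (rule invariant_under_image_disjoint)
    show "c \<circ> h \<in> G" using is_subgroupD(3)[OF G] that C(2) pstab_subset by blast
  qed
  then have "x \<notin> \<Delta>" if "x \<in> V" for x using subsetD[OF V(2) that] by blast
  then have "V \<inter> \<Delta> = {}" by blast
  moreover have "encodes_on_cosets G \<Delta> Z p" using G C(3) V(4) by (rule encodes_on_cosets_if_representatives)
  ultimately show ?thesis using that Z(1,2) Z_\<Delta> V(1,3) by blast
qed

locale encoding_chain =
  fixes G :: "('a \<Rightarrow> 'a) set" and \<Delta> Z :: "nat \<Rightarrow> 'a set" and p :: "nat \<Rightarrow> 'a \<Rightarrow> 'a"
  assumes subgroup: "is_subgroup G"
    and invariant: "invariant_under G (\<Delta> n)"
    and increasing: "\<Delta> n \<subseteq> \<Delta> (Suc n)"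
    and exhausting: "(\<Union>n. \<Delta> n) = UNIV"
    and block_in_layer: "Z n \<subseteq> \<Delta> (Suc n) - \<Delta> n"
    and permutes_layer: "p n permutes \<Delta> (Suc n) - \<Delta> n"
    and encodes: "encodes_on_cosets G (\<Delta> n) (Z n) (p n)"
begin

lemma disjoint_layers: "disjoint_family (\<lambda>n. \<Delta> (Suc n) - \<Delta> n)"
  using increasing by (rule disjoint_family_Suc)

lemma disjoint_blocks: "disjoint_family Z"
  using disjoint_layers block_in_layer by (rule disjoint_family_subset)

lemma ex_coherent_intertwiners:
  assumes \<pi>: "\<pi> \<in> Sym_blocks (range Z)"
  obtains g where "\<And>n. g n \<in> G" "\<And>n x. x \<in> \<Delta> n \<Longrightarrow> g (Suc n) x = g n x"
    "\<And>n. intertwiner_on (Z n) (g (Suc n)) \<pi> (p n)"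
proof -
  have \<pi>_Z: "restrict_id \<pi> (Z n) permutes Z n" for n
    using \<pi> by (intro permutes_restrict_id) (auto simp: Sym_blocks_iff intro: bij_betw_imageI permutes_inj_on)
  have "\<exists>g. \<forall>n. g n \<in> G \<and> ((\<forall>x\<in>\<Delta> n. g (Suc n) x = g n x) \<and> intertwiner_on (Z n) (g (Suc n)) \<pi> (p n))"
  proof (rule dependent_nat_choice)
    show "\<exists>g. g \<in> G" using is_subgroupD(2)[OF subgroup] by blast
    fix c n assume c: "c \<in> G"
    obtain h where h: "h \<in> pstab G (\<Delta> n)" "intertwiner_on (Z n) (c \<circ> h) (restrict_id \<pi> (Z n)) (p n)"
      using encodes[of n] c \<pi>_Z unfolding encodes_on_cosets_def by blast
    have "c \<circ> h \<in> G" using c h(1) is_subgroupD(3)[OF subgroup] by (simp add: pstab_def)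
    moreover have "\<forall>x\<in>\<Delta> n. (c \<circ> h) x = c x" using h(1) by (simp add: pstab_def)
    moreover have "intertwiner_on (Z n) (c \<circ> h) \<pi> (p n)" using h(2) by (simp add: intertwiner_on_def)
    ultimately show "\<exists>g. g \<in> G \<and> ((\<forall>x\<in>\<Delta> n. g x = c x) \<and> intertwiner_on (Z n) g \<pi> (p n))" by blast
  qed
  then show ?thesis using that by blast
qed

lemma ex_intertwiner:
  assumes closed: "closed_in_Sym G" and u: "\<And>n x. x \<in> \<Delta> (Suc n) - \<Delta> n \<Longrightarrow> u x = p n x"
    and \<pi>: "\<pi> \<in> Sym_blocks (range Z)"
  shows "\<exists>l\<in>G. intertwiner_on (\<Union>n. Z n) l \<pi> u"
proof -
  obtain g where g: "\<And>n. g n \<in> G" "\<And>n x. x \<in> \<Delta> n \<Longrightarrow> g (Suc n) x = g n x"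
    "\<And>n. intertwiner_on (Z n) (g (Suc n)) \<pi> (p n)"
    using ex_coherent_intertwiners[OF \<pi>] by blast
  have surj: "(\<Union>n. g n ` \<Delta> n) = UNIV" using invariant exhausting g(1) by (simp add: invariant_under_def)
  obtain l where l: "l \<in> G" "\<And>n x. x \<in> \<Delta> n \<Longrightarrow> l x = g n x"
    using pointwise_limit_in_closed[where g = g and \<Delta> = \<Delta>, OF subgroup closed g(1) increasing exhausting surj g(2)]
    by blast
  have "u (l z) = l (\<pi> z)" if z: "z \<in> Z n" for n z
  proof -
    have layer: "l ` (\<Delta> (Suc n) - \<Delta> n) = \<Delta> (Suc n) - \<Delta> n"
      using invariant l(1) is_subgroupD(1)[OF subgroup l(1)]
      by (simp add: invariant_under_def image_set_diff bij_is_inj)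
    have "\<pi> z \<in> Z n" using \<pi> z by (auto simp: Sym_blocks_iff)
    then have "l z = g (Suc n) z" "l (\<pi> z) = g (Suc n) (\<pi> z)" using z block_in_layer l(2) by blast+
    moreover have "u (l z) = p n (l z)" using z block_in_layer layer by (intro u) blast
    ultimately show ?thesis using g(3)[of n] z by (simp add: intertwiner_on_def)
  qed
  then show ?thesis using l(1) by (auto simp: intertwiner_on_def)
qed

lemma ex_encoding_permutation_of_union:
  assumes "closed_in_Sym G"
  obtains u where "bij u" "\<And>\<pi>. \<pi> \<in> Sym_blocks (range Z) \<Longrightarrow> \<exists>g\<in>G. intertwiner_on (\<Union>n. Z n) g \<pi> u"
proof -
  obtain u where u: "u permutes (\<Union>n. \<Delta> (Suc n) - \<Delta> n)" "\<And>n x. x \<in> \<Delta> (Suc n) - \<Delta> n \<Longrightarrow> u x = p n x"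
    by (rule glue_permutations[OF disjoint_layers permutes_imp_bij[OF permutes_layer]]) blast
  show ?thesis using that permutes_bij[OF u(1)] ex_intertwiner[OF assms u(2)] by blast
qed

end

lemma ex_encoding_chain:
  fixes G :: "('a::countable \<Rightarrow> 'a) set" and s :: "nat \<Rightarrow> nat"
  assumes G: "is_subgroup G" and finite: "finite_orbits G"
    and unbounded: "\<not> some_pstab bounded_orbits G"
  obtains \<Delta> Z p where "encoding_chain G \<Delta> Z p" "\<And>n. finite (Z n)" "\<And>n. card (Z n) = s n"
proof -
  have "\<exists>\<Delta>. \<forall>n. (finite (\<Delta> n) \<and> invariant_under G (\<Delta> n)) \<and>
      (\<Delta> n \<subseteq> \<Delta> (Suc n) \<and> from_nat n \<in> \<Delta> (Suc n) \<and>
       (\<exists>Z p. finite Z \<and> card Z = s n \<and> Z \<subseteq> \<Delta> (Suc n) - \<Delta> n \<and> p permutes \<Delta> (Suc n) - \<Delta> n \<and>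
         encodes_on_cosets G (\<Delta> n) Z p))"
  proof (rule dependent_nat_choice)
    show "\<exists>\<Delta>. finite \<Delta> \<and> invariant_under G \<Delta>" by (intro exI[of _ "{}"]) (simp add: invariant_under_def)
    fix \<Delta> n assume \<Delta>: "finite \<Delta> \<and> invariant_under G \<Delta>"
    then obtain Z V p where step: "finite Z" "card Z = s n" "Z \<inter> \<Delta> = {}" "finite V" "V \<inter> \<Delta> = {}"
        "p permutes V" "encodes_on_cosets G \<Delta> Z p"
      using ex_encoding_step[OF G finite unbounded, of \<Delta> "s n"] by blast
    obtain \<Delta>' where \<Delta>': "finite \<Delta>'" "invariant_under G \<Delta>'" "insert (from_nat n) (\<Delta> \<union> Z \<union> V) \<subseteq> \<Delta>'"
      using ex_finite_invariant_superset[OF G finite, of "insert (from_nat n) (\<Delta> \<union> Z \<union> V)"] \<Delta> step(1,4)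
      by auto
    have "p permutes \<Delta>' - \<Delta>" using step(6) by (rule permutes_subset) (use \<Delta>'(3) step(5) in blast)
    moreover have "Z \<subseteq> \<Delta>' - \<Delta>" using \<Delta>'(3) step(3) by blast
    ultimately show "\<exists>\<Delta>'. (finite \<Delta>' \<and> invariant_under G \<Delta>') \<and>
        (\<Delta> \<subseteq> \<Delta>' \<and> from_nat n \<in> \<Delta>' \<and> (\<exists>Z p. finite Z \<and> card Z = s n \<and> Z \<subseteq> \<Delta>' - \<Delta> \<and>
          p permutes \<Delta>' - \<Delta> \<and> encodes_on_cosets G \<Delta> Z p))"
      using step(1,2,7) \<Delta>' by (intro exI[of _ \<Delta>']) auto
  qed
  then obtain \<Delta> where \<Delta>: "\<And>n. invariant_under G (\<Delta> n)" "\<And>n. \<Delta> n \<subseteq> \<Delta> (Suc n)" "\<And>n. from_nat n \<in> \<Delta> (Suc n)"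
    and "\<forall>n. \<exists>Z p. finite Z \<and> card Z = s n \<and> Z \<subseteq> \<Delta> (Suc n) - \<Delta> n \<and> p permutes \<Delta> (Suc n) - \<Delta> n \<and>
         encodes_on_cosets G (\<Delta> n) Z p"
    by blast
  moreover from this obtain Z p where Z: "\<And>n. finite (Z n)" "\<And>n. card (Z n) = s n"
    and "\<And>n. Z n \<subseteq> \<Delta> (Suc n) - \<Delta> n" "\<And>n. p n permutes \<Delta> (Suc n) - \<Delta> n"
      "\<And>n. encodes_on_cosets G (\<Delta> n) (Z n) (p n)"
    by metis
  moreover have "x \<in> (\<Union>n. \<Delta> n)" for x using \<Delta>(3)[of "to_nat x"] by auto
  then have "(\<Union>n. \<Delta> n) = UNIV" by auto
  ultimately have "encoding_chain G \<Delta> Z p" using G by unfold_locales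
  then show ?thesis using that Z by blast
qed


section \<open>Recovering block permutations from a closed group\<close>

lemma ex_shift:
  fixes Z :: "'k \<times> int \<Rightarrow> 'a set"
  assumes Z: "disjoint_family Z" "\<And>k i. finite (Z (k, i))" "\<And>k i. card (Z (k, i)) = card (Z (k, 0))"
  obtains v where "v permutes (\<Union>m. Z m)" "\<And>k i. v ` Z (k, i) = Z (k, i + 1)"
proof -
  define succ where "succ m = (fst m, snd m + 1)" for m :: "'k \<times> int"
  have "bij succ" by (rule o_bij[of "\<lambda>m. (fst m, snd m - 1)"]) (auto simp: succ_def fun_eq_iff)
  have "\<exists>f. bij_betw f (Z m) (Z (succ m))" for m
    using Z(2,3) by (cases m) (metis finite_same_card_bij fst_conv succ_def)
  then obtain f where f: "\<And>m. bij_betw (f m) (Z m) (Z (succ m))" by metis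
  have "disjoint_family (\<lambda>m. Z (succ m))"
    using Z(1) inj_eq[OF bij_is_inj[OF \<open>bij succ\<close>]] unfolding disjoint_family_on_def by blast
  then obtain w where w: "bij_betw w (\<Union>m. Z m) (\<Union>m. Z (succ m))" "\<And>m x. x \<in> Z m \<Longrightarrow> w x = f m x"
    by (rule glue_bijections[OF Z(1) _ f]) blast
  have "(\<Union>m. Z (succ m)) = (\<Union>m\<in>range succ. Z m)" by simp
  then have "(\<Union>m. Z (succ m)) = (\<Union>m. Z m)" by (simp only: bij_is_surj[OF \<open>bij succ\<close>])
  then have "restrict_id w (\<Union>m. Z m) permutes (\<Union>m. Z m)" using w(1) by (intro permutes_restrict_id) simp
  moreover have "restrict_id w (\<Union>m. Z m) ` Z (k, i) = Z (k, i + 1)" for k i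
  proof -
    have "restrict_id w (\<Union>m. Z m) x = f (k, i) x" if "x \<in> Z (k, i)" for x
      using that w(2)[OF that] by (subst restrict_id_simps(1)) auto
    then show ?thesis using bij_betw_imp_surj_on[OF f[of "(k, i)"]] by (simp add: succ_def cong: image_cong)
  qed
  ultimately show ?thesis using that by blast
qed

lemma Sym_blocks_fixes_other_blocks:
  assumes Z: "disjoint_family Z" and \<sigma>: "\<sigma> \<in> Sym_blocks (Z ` M)" and "x \<in> Z m" "m \<notin> M"
  shows "\<sigma> x = x"
proof (rule Sym_blocks_fixes[OF \<sigma>])
  have "x \<notin> Z l" if "l \<in> M" for l using that assms(3,4) disjoint_family_onD[OF Z, of m l] by auto
  then show "x \<notin> \<Union>(Z ` M)" by blast
qed

text \<open>An infinite swindle: if \<open>w\<close> carries a conjugate of \<open>\<sigma>\<close> on every block \<open>Z (k, i)\<close> with \<open>i \<ge> 0\<close> and is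
  trivial on those with \<open>i < 0\<close>, then in the commutator of \<open>w\<close> with the shift \<open>v\<close> all conjugates cancel
  except the one at \<open>i = 0\<close>, and so does the uncontrolled part of \<open>w\<close> outside the blocks.\<close>

lemma shift_commutator_eq:
  fixes Z :: "'k \<times> int \<Rightarrow> 'a set"
  assumes Z: "disjoint_family Z"
    and v: "v permutes (\<Union>m. Z m)" "\<And>k i. v ` Z (k, i) = Z (k, i + 1)"
    and \<sigma>: "\<sigma> \<in> Sym_blocks (range (\<lambda>k. Z (k, 0)))"
    and w: "bij w" "w ` (\<Union>m. Z m) = (\<Union>m. Z m)"
      "\<And>k i x. x \<in> Z (k, i) \<Longrightarrow> i < 0 \<Longrightarrow> w x = x"
      "\<And>k x. x \<in> Z (k, 0) \<Longrightarrow> w x = \<sigma> x"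
      "\<And>k i x. x \<in> Z (k, i) \<Longrightarrow> 0 \<le> i \<Longrightarrow> w x \<in> Z (k, i) \<and> w (v x) = v (w x)"
  shows "\<sigma> = w \<circ> v \<circ> inv (v \<circ> w)"
proof -
  have "\<sigma> \<in> Sym_blocks (Z ` range (\<lambda>k. (k, 0)))" using \<sigma> by (simp only: image_image)
  then have \<sigma>_id: "\<sigma> x = x" if "x \<in> Z (k, i)" "i \<noteq> 0" for x k i
    using that by (intro Sym_blocks_fixes_other_blocks[OF Z, of \<sigma> _ x "(k, i)"]) auto
  have "w (v x) = \<sigma> (v (w x))" for x
  proof (cases "x \<in> (\<Union>m. Z m)")
    case True
    then obtain k i where x: "x \<in> Z (k, i)" by auto
    then have vx: "v x \<in> Z (k, i + 1)" using v(2) by blast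
    consider (below) "i < -1" | (adjacent) "i = -1" | (above) "0 \<le> i" by linarith
    then show ?thesis
    proof cases
      case below
      then show ?thesis using x vx w(3) \<sigma>_id by simp
    next
      case adjacent
      then show ?thesis using x vx w(3,4) by simp
    next
      case above
      then have "v (w x) \<in> Z (k, i + 1)" using w(5)[OF x] v(2) by blast
      then show ?thesis using above w(5)[OF x] \<sigma>_id by simp
    qed
  next
    case False
    then have "w x \<notin> (\<Union>m. Z m)" using w(2) inj_image_mem_iff[OF bij_is_inj[OF w(1)]] by metis
    moreover from this have "\<sigma> (w x) = w x" by (intro Sym_blocks_fixes[OF \<sigma>]) blast
    ultimately show ?thesis using False v(1) by (simp add: permutes_not_in)
  qed
  then have "\<sigma> \<circ> (v \<circ> w) = w \<circ> v" by auto
  then show ?thesis by (simp only: comp_eq_iff_eq_comp_inv[OF bij_comp[OF w(1) permutes_bij[OF v(1)]]])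
qed

lemma funpow_shift_image:
  assumes "\<And>i. v ` Z (k, i) = Z (k, i + 1)"
  shows "(v ^^ n) ` Z (k, 0) = Z (k, int n)"
proof (induction n)
  case (Suc n)
  have "(v ^^ Suc n) ` Z (k, 0) = v ` (v ^^ n) ` Z (k, 0)" by (simp only: funpow.simps image_comp)
  then show ?case using Suc assms by (simp add: add.commute)
qed simp

lemma ex_shift_conjugates:
  fixes Z :: "'k \<times> int \<Rightarrow> 'a set"
  assumes Z: "disjoint_family Z"
    and v: "v permutes (\<Union>m. Z m)" "\<And>k i. v ` Z (k, i) = Z (k, i + 1)"
    and \<sigma>: "\<sigma> \<in> Sym_blocks (range (\<lambda>k. Z (k, 0)))"
  obtains \<pi> where "\<pi> \<in> Sym_blocks (range Z)"
    "\<And>k i x. x \<in> Z (k, i) \<Longrightarrow> i < 0 \<Longrightarrow> \<pi> x = x"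
    "\<And>k x. x \<in> Z (k, 0) \<Longrightarrow> \<pi> x = \<sigma> x"
    "\<And>k i x. x \<in> Z (k, i) \<Longrightarrow> 0 \<le> i \<Longrightarrow> \<pi> (v x) = v (\<pi> x)"
proof -
  have bij_v: "bij v" using v(1) by (rule permutes_bij)
  define \<rho> where "\<rho> n = (v ^^ n) \<circ> \<sigma> \<circ> inv (v ^^ n)" for n
  have \<rho>_0: "\<rho> 0 = \<sigma>" by (simp add: \<rho>_def)
  have \<rho>_Suc: "\<rho> (Suc n) (v x) = v (\<rho> n x)" for n x
    using bij_v by (simp add: \<rho>_def o_inv_distrib bij_is_inj)
  have \<rho>_bij: "bij_betw (\<rho> n) (Z (k, int n)) (Z (k, int n))" for k n
  proof -
    have "\<rho> n \<in> Sym_blocks ((`) (v ^^ n) ` range (\<lambda>k. Z (k, 0)))"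
      unfolding \<rho>_def using bij_fn[OF bij_v] \<sigma> by (rule Sym_blocks_conjugate)
    then have "\<rho> n \<in> Sym_blocks (range (\<lambda>k. Z (k, int n)))"
      by (simp add: image_image funpow_shift_image[of v Z, OF v(2)])
    then show ?thesis by (auto simp: Sym_blocks_iff intro: bij_betw_imageI permutes_inj_on)
  qed
  define \<tau> where "\<tau> m = (if snd m < 0 then id else \<rho> (nat (snd m)))" for m :: "'k \<times> int"
  have \<tau>_bij: "bij_betw (\<tau> m) (Z m) (Z m)" for m
    using \<rho>_bij[of "nat (snd m)" "fst m"] by (cases m) (auto simp: \<tau>_def)
  obtain \<pi> where \<pi>: "\<pi> permutes (\<Union>m. Z m)" "\<And>m x. x \<in> Z m \<Longrightarrow> \<pi> x = \<tau> m x" "\<And>m. \<pi> ` Z m = Z m"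
    by (rule glue_permutations[OF Z \<tau>_bij]) blast
  show ?thesis
  proof (rule that)
    show "\<pi> \<in> Sym_blocks (range Z)" using \<pi>(1,3) by (simp add: Sym_blocks_iff)
    show "\<pi> x = x" if "x \<in> Z (k, i)" "i < 0" for k i x using \<pi>(2)[OF that(1)] that(2) by (simp add: \<tau>_def)
    show "\<pi> x = \<sigma> x" if "x \<in> Z (k, 0)" for k x using \<pi>(2)[OF that] by (simp add: \<tau>_def \<rho>_0)
    show "\<pi> (v x) = v (\<pi> x)" if "x \<in> Z (k, i)" "0 \<le> i" for k i x
    proof -
      have "v x \<in> Z (k, i + 1)" using that(1) v(2) by blast
      then have "\<pi> (v x) = \<rho> (nat (i + 1)) (v x)" using \<pi>(2)[of "v x" "(k, i + 1)"] that(2) by (simp add: \<tau>_def)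
      also have "nat (i + 1) = Suc (nat i)" using that(2) by simp
      finally show ?thesis using \<pi>(2)[OF that(1)] that(2) by (simp add: \<rho>_Suc \<tau>_def)
    qed
  qed
qed

lemma Sym_blocks_subset_gen_by_shift:
  fixes Z :: "'k \<times> int \<Rightarrow> 'a set"
  assumes G: "G \<subseteq> Sym" and u: "bij u" and Z: "disjoint_family Z"
    and encodes: "\<And>\<pi>. \<pi> \<in> Sym_blocks (range Z) \<Longrightarrow> \<exists>g\<in>G. intertwiner_on (\<Union>m. Z m) g \<pi> u"
    and v: "v permutes (\<Union>m. Z m)" "\<And>k i. v ` Z (k, i) = Z (k, i + 1)"
  shows "Sym_blocks (range (\<lambda>k. Z (k, 0))) \<subseteq> gen_by (G \<union> {u, v})"
proof
  fix \<sigma> assume \<sigma>: "\<sigma> \<in> Sym_blocks (range (\<lambda>k. Z (k, 0)))"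
  obtain \<pi> where \<pi>: "\<pi> \<in> Sym_blocks (range Z)"
    "\<And>k i x. x \<in> Z (k, i) \<Longrightarrow> i < 0 \<Longrightarrow> \<pi> x = x"
    "\<And>k x. x \<in> Z (k, 0) \<Longrightarrow> \<pi> x = \<sigma> x"
    "\<And>k i x. x \<in> Z (k, i) \<Longrightarrow> 0 \<le> i \<Longrightarrow> \<pi> (v x) = v (\<pi> x)"
    using ex_shift_conjugates[OF Z v \<sigma>] by blast
  obtain g where g: "g \<in> G" "intertwiner_on (\<Union>m. Z m) g \<pi> u" using encodes[OF \<pi>(1)] by blast
  have bij_g: "bij g" using g(1) G by (auto simp: Sym_def)
  define w where "w = inv g \<circ> u \<circ> g"
  have bij_w: "bij w" unfolding w_def using bij_g u by (intro bij_comp bij_imp_bij_inv)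
  have w: "w x = \<pi> x" if "x \<in> Z m" for x m
  proof -
    have "u (g x) = g (\<pi> x)" using g(2) that unfolding intertwiner_on_def by blast
    then show ?thesis using bij_g by (simp add: w_def bij_is_inj)
  qed
  have \<pi>_Z: "\<pi> ` Z m = Z m" for m using \<pi>(1) unfolding Sym_blocks_iff by blast
  have "\<sigma> = w \<circ> v \<circ> inv (v \<circ> w)"
  proof (rule shift_commutator_eq[OF Z v \<sigma> bij_w])
    have "w ` Z m = Z m" for m using w[of _ m] \<pi>_Z[of m] by (simp cong: image_cong)
    then show "w ` (\<Union>m. Z m) = (\<Union>m. Z m)" by (simp add: image_UN)
    fix k i x assume x: "x \<in> Z (k, i)"
    show "w x = x" if "i < 0" using w[OF x] \<pi>(2)[OF x that] by simp
    have "v x \<in> Z (k, i + 1)" "\<pi> x \<in> Z (k, i)" using x v(2) \<pi>_Z by blast+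
    then show "w x \<in> Z (k, i) \<and> w (v x) = v (w x)" if "0 \<le> i" using w x \<pi>(4)[OF x that] by simp
  qed (simp add: w \<pi>(3))
  moreover have "w \<in> gen_by (G \<union> {u, v})" "v \<in> gen_by (G \<union> {u, v})"
    unfolding w_def using g(1) by (auto intro!: gen_by.gen_comp gen_by.gen_inv intro: gen_by.gen_base)
  ultimately show "\<sigma> \<in> gen_by (G \<union> {u, v})" by (simp only: gen_by.gen_comp gen_by.gen_inv)
qed

lemma unbounded_orbits_imp_Sym_blocks_preceq:
  fixes G :: "('a::countable \<Rightarrow> 'a) set"
  assumes G: "is_subgroup G" "closed_in_Sym G" and finite: "finite_orbits G"
    and unbounded: "\<not> some_pstab bounded_orbits G"
  obtains C :: "nat \<Rightarrow> 'a set" where "disjoint_family C" "\<And>n. finite (C n)" "\<And>n. card (C n) = n"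
    "preceq (Sym_blocks (range C)) G"
proof -
  define s where "s n = fst (from_nat n :: nat \<times> int)" for n
  obtain \<Delta> Y :: "nat \<Rightarrow> 'a set" and p where chain: "encoding_chain G \<Delta> Y p"
    and Y: "\<And>n. finite (Y n)" "\<And>n. card (Y n) = s n"
    using ex_encoding_chain[OF G(1) finite unbounded, of s] by blast
  interpret encoding_chain G \<Delta> Y p by (rule chain)
  obtain u where u: "bij u" "\<And>\<pi>. \<pi> \<in> Sym_blocks (range Y) \<Longrightarrow> \<exists>g\<in>G. intertwiner_on (\<Union>n. Y n) g \<pi> u"
    using ex_encoding_permutation_of_union[OF G(2)] by blast
  define Z where "Z m = Y (to_nat m)" for m :: "nat \<times> int"
  have Z: "disjoint_family Z" "\<And>m. finite (Z m)" "\<And>k i. card (Z (k, i)) = k"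
    using Y disjoint_blocks by (auto simp: Z_def s_def disjoint_family_on_def)
  have encodes: "\<exists>g\<in>G. intertwiner_on (\<Union>m. Z m) g \<pi> u" if \<pi>: "\<pi> \<in> Sym_blocks (range Z)" for \<pi>
  proof -
    have "Sym_blocks (range Z) \<subseteq> Sym_blocks (range Y)"
      using disjoint_family_on_disjoint_image[OF disjoint_blocks] by (rule Sym_blocks_refine) (auto simp: Z_def)
    then obtain g where "g \<in> G" "intertwiner_on (\<Union>n. Y n) g \<pi> u" using u(2) \<pi> by blast
    then show ?thesis by (auto simp: intertwiner_on_def Z_def)
  qed
  obtain v where v: "v permutes (\<Union>m. Z m)" "\<And>k i. v ` Z (k, i) = Z (k, i + 1)"
    using ex_shift[OF Z(1,2)] Z(3) by metis
  have "G \<subseteq> Sym" using G(1) by (simp add: is_subgroup_def)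
  then have "Sym_blocks (range (\<lambda>k. Z (k, 0))) \<subseteq> gen_by (G \<union> {u, v})"
    using u(1) Z(1) encodes v by (rule Sym_blocks_subset_gen_by_shift)
  then have "preceq (Sym_blocks (range (\<lambda>k. Z (k, 0)))) G"
    unfolding preceq_def using u(1) permutes_bij[OF v(1)] by (intro exI[of _ "{u, v}"]) (auto simp: Sym_def)
  moreover have "disjoint_family (\<lambda>k. Z (k, 0))" using Z(1) by (auto simp: disjoint_family_on_def)
  ultimately show ?thesis using that[of "\<lambda>k. Z (k, 0)"] Z(2,3) by blast
qed


section \<open>The equivalence class of the groups \<open>Sym_part A\<close>\<close>

lemma unbounded_partitions_nonempty:
  assumes inf: "infinite (UNIV :: 'a::countable set)"
  shows "(unbounded_partitions :: 'a set set set) \<noteq> {}"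
proof -
  obtain e :: "nat \<Rightarrow> 'a" where e: "bij e"
    using bij_betw_from_nat_into[OF countableI_type inf] by blast
  define H where "H n = e ` {..<n * n}" for n
  have H: "card (H n) = n * n" "finite (H n)" for n
    unfolding H_def using bij_is_inj[OF e] by (simp_all add: card_image inj_on_subset[OF _ subset_UNIV])
  have "{..<m * m} \<subseteq> {..<n * n}" if "m \<le> n" for m n :: nat using mult_mono[OF that that] by auto
  then have "mono H" by (simp add: H_def mono_def image_mono)
  let ?A = "range (disjointed H) - {{}}"
  have "e n \<in> H (Suc n)" for n by (simp add: H_def)
  then have "range e \<subseteq> (\<Union>n. H n)" by blast
  then have "(\<Union>n. H n) = UNIV" unfolding bij_is_surj[OF e] by blast
  then have "finite_block_partition ?A" using H(2) by (intro finite_block_partition_disjointed)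
  moreover have "\<exists>B\<in>?A. n < card B" for n
  proof
    have "H n \<subseteq> H (Suc n)" using \<open>mono H\<close> by (simp add: mono_def)
    then have card: "card (disjointed H (Suc n)) = 2 * n + 1"
      by (simp add: disjointed_mono[OF \<open>mono H\<close>] card_Diff_subset H)
    then show "n < card (disjointed H (Suc n))" by simp
    show "disjointed H (Suc n) \<in> ?A" using card by auto
  qed
  ultimately have "?A \<in> unbounded_partitions" by (simp add: unbounded_partitions_def not_le)
  then show ?thesis by blast
qed

lemma closed_preceq_Sym_part_iff:
  fixes G :: "('a::countable \<Rightarrow> 'a) set"
  assumes inf: "infinite (UNIV :: 'a set)" and G: "is_subgroup G" "closed_in_Sym G"
    and A: "A \<in> unbounded_partitions"
  shows "preceq G (Sym_part A) \<longleftrightarrow> some_pstab finite_orbits G"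
proof
  have "some_pstab finite_orbits (Sym_part A)"
    by (intro some_pstabI finite_orbits_Sym_part unbounded_partitionsD(1)[OF A])
  moreover assume "preceq G (Sym_part A)"
  ultimately have "countably_covered finite_orbits G"
    by (rule finite_orbits.countably_covered_preceq[OF is_subgroup_Sym_part])
  then show "some_pstab finite_orbits G" by (rule closed_covered_imp_some_pstab[OF G])
next
  assume "some_pstab finite_orbits G"
  then have "countably_covered finite_orbits G"
    by (rule finite_orbits.countably_covered_preceq[OF G(1) _ preceq_subset[OF subset_refl]])
  then show "preceq G (Sym_part A)"
    by (rule finite_orbits_covered_imp_preceq_Sym_part[OF inf G(1) _ A])
qed

lemma unbounded_orbits_imp_Sym_part_preceq:
  fixes G :: "('a::countable \<Rightarrow> 'a) set"
  assumes inf: "infinite (UNIV :: 'a set)" and G: "is_subgroup G" "closed_in_Sym G"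
    and A: "finite_block_partition A"
    and orbits: "some_pstab finite_orbits G" "\<not> some_pstab bounded_orbits G"
  shows "preceq (Sym_part A) G"
proof -
  obtain \<Gamma> where \<Gamma>: "finite \<Gamma>" "finite_orbits (pstab G \<Gamma>)" using orbits(1) by (auto simp: some_pstab_def)
  moreover have "\<not> some_pstab bounded_orbits (pstab G \<Gamma>)" using orbits(2) \<Gamma>(1) some_pstab_pstab by blast
  ultimately obtain C :: "nat \<Rightarrow> 'a set" where C: "disjoint_family C" "\<And>n. finite (C n)" "\<And>n. card (C n) = n"
    and le: "preceq (Sym_blocks (range C)) (pstab G \<Gamma>)"
    using unbounded_orbits_imp_Sym_blocks_preceq is_subgroup_pstab[OF G(1)] closed_in_Sym_pstab[OF G(2)] by metis
  have "\<exists>B\<in>range C. m < card B" for m using C(3)[of "Suc m"] by (intro bexI[of _ "C (Suc m)"]) auto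
  then have "unbounded_family (range C)"
    using disjoint_family_on_disjoint_image[OF C(1)] C(2) by (auto simp: unbounded_family_def)
  with inf A have "preceq (Sym_part A) (Sym_blocks (range C))" by (rule Sym_part_preceq_Sym_blocks)
  also note le
  also have "preceq (pstab G \<Gamma>) G" by (rule preceq_subset[OF pstab_subset])
  finally show ?thesis .
qed

lemma Sym_part_preceq_closed_iff:
  fixes G :: "('a::countable \<Rightarrow> 'a) set"
  assumes inf: "infinite (UNIV :: 'a set)" and G: "is_subgroup G" "closed_in_Sym G"
    and A: "A \<in> unbounded_partitions" and finite: "some_pstab finite_orbits G"
  shows "preceq (Sym_part A) G \<longleftrightarrow> \<not> some_pstab bounded_orbits G"
proof
  assume "preceq (Sym_part A) G"
  then show "\<not> some_pstab bounded_orbits G"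
    using bounded_orbits.countably_covered_preceq[OF G(1)] unbounded_Sym_part_not_bounded_covered[OF A] by blast
next
  assume "\<not> some_pstab bounded_orbits G"
  with unbounded_partitionsD(1)[OF A] finite show "preceq (Sym_part A) G"
    by (rule unbounded_orbits_imp_Sym_part_preceq[OF inf G])
qed

lemma not_some_pstab_finite_orbits_Sym:
  assumes inf: "infinite (UNIV :: 'a set)"
  shows "\<not> some_pstab finite_orbits (Sym :: ('a \<Rightarrow> 'a) set)"
proof
  assume "some_pstab finite_orbits (Sym :: ('a \<Rightarrow> 'a) set)"
  then obtain \<Gamma> :: "'a set" where \<Gamma>: "finite \<Gamma>" "finite_orbits (pstab Sym \<Gamma>)" by (auto simp: some_pstab_def)
  obtain x where x: "x \<notin> \<Gamma>" using \<Gamma>(1) inf by (metis UNIV_eq_I)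
  have "- \<Gamma> \<subseteq> orbit_of (pstab Sym \<Gamma>) x"
  proof
    fix y assume "y \<in> - \<Gamma>"
    then have "Transposition.transpose x y \<in> pstab Sym \<Gamma>"
      using x by (auto simp: pstab_def Sym_def Transposition.transpose_def)
    then have "Transposition.transpose x y x \<in> orbit_of (pstab Sym \<Gamma>) x" unfolding orbit_of_def by blast
    then show "y \<in> orbit_of (pstab Sym \<Gamma>) x" by simp
  qed
  then have "finite (- \<Gamma>)" using \<Gamma>(2) finite_subset unfolding finite_orbits_def by blast
  then show False using \<Gamma>(1) inf by simp
qed

lemma Sym_part_prec_Sym:
  fixes A :: "'a::countable set set"
  assumes inf: "infinite (UNIV :: 'a set)" and A: "A \<in> unbounded_partitions"
  shows "prec (Sym_part A) Sym"
proof -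
  have "closed_in_Sym Sym" by (simp add: closed_in_Sym_def)
  then have "\<not> preceq Sym (Sym_part A)"
    using closed_preceq_Sym_part_iff[OF inf is_subgroup_Sym _ A] not_some_pstab_finite_orbits_Sym[OF inf] by blast
  moreover have "preceq (Sym_part A) Sym" by (rule preceq_subset) (auto simp: Sym_part_def)
  ultimately show ?thesis by (simp add: prec_def)
qed

theorem theorem6p2:
  assumes "infinite (UNIV :: ('a::countable) set)"
  shows "(\<forall>A\<in>(unbounded_partitions :: 'a set set set). \<forall>B\<in>unbounded_partitions.
            equiv_sg (Sym_part A) (Sym_part B))
       \<and> (\<forall>G :: ('a \<Rightarrow> 'a) set. is_subgroup G \<and> closed_in_Sym G \<longrightarrow>
            ((\<forall>A\<in>unbounded_partitions. equiv_sg G (Sym_part A)) \<longleftrightarrow>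
              ((\<exists>\<Gamma>. finite \<Gamma> \<and> (\<forall>x. finite (orbit_of (pstab G \<Gamma>) x))) \<and>
               \<not> (\<exists>\<Gamma>. finite \<Gamma> \<and> (\<exists>n::nat. \<forall>x. finite (orbit_of (pstab G \<Gamma>) x)
                                                 \<and> card (orbit_of (pstab G \<Gamma>) x) \<le> n)))))
       \<and> (\<forall>A\<in>(unbounded_partitions :: 'a set set set). prec (Sym_part A) Sym)"
  unfolding finite_orbits_def[symmetric] bounded_orbits_def[symmetric] some_pstab_def[symmetric]
proof (intro conjI ballI allI impI)
  fix A B :: "'a set set" assume "A \<in> unbounded_partitions" "B \<in> unbounded_partitions"
  then show "equiv_sg (Sym_part A) (Sym_part B)"
    unfolding equiv_sg_def using Sym_part_preceq_Sym_part[OF assms] unbounded_partitionsD(1) by blast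
next
  fix G :: "('a \<Rightarrow> 'a) set" assume "is_subgroup G \<and> closed_in_Sym G"
  then have "equiv_sg G (Sym_part A) \<longleftrightarrow> some_pstab finite_orbits G \<and> \<not> some_pstab bounded_orbits G"
    if "A \<in> unbounded_partitions" for A
    unfolding equiv_sg_def
    using closed_preceq_Sym_part_iff[OF assms _ _ that] Sym_part_preceq_closed_iff[OF assms _ _ that] by blast
  then show "(\<forall>A\<in>unbounded_partitions. equiv_sg G (Sym_part A)) \<longleftrightarrow>
      some_pstab finite_orbits G \<and> \<not> some_pstab bounded_orbits G"
    using unbounded_partitions_nonempty[OF assms] by blast
qed (rule Sym_part_prec_Sym[OF assms])

end
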